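(* Let $e=\begin{pmatrix}-q^{-1}b_0&qb_-\\-b_+&1+qb_0\end{pmatrix}\in M_2(\mathbb{C}_q[S^2])$. Then, as left $\mathbb{C}_q[S^2]$-modules, $$\mathcal{S}_-\cong\mathbb{C}_q[S^2]^{\oplus2}(1-e),\qquad \mathcal{S}_+\cong\mathbb{C}_q[S^2]^{\oplus2}e,\qquad \mathcal{S}\cong\mathbb{C}_q[S^2]^{\oplus2}.$$ With $\lambda=q^{-1/2}$ and the trivialisation $\mathbb{C}_q[S^2]^{\oplus2}\to\mathcal{S}$, $(f,g)\mapsto f(a+\lambda b)+g(c+\lambda d)$, the covariant derivative and Dirac operator, acting from the right on row 2-vectors $(f,g)$, are $$D=\mathrm{d}+(\mathrm{d}e)e-e\,\mathrm{d}e,$$ $$\nabla\!\!\!\!/=\lambda q+\lambda q^{-1}(\overset{\leftarrow}{\partial}_ib_i)(1+(q^4-1)e)+\lambda q^2\begin{pmatrix}\overset{\leftarrow}{\partial}_0&q^{-1}\overset{\leftarrow}{\partial}_+\\-\overset{\leftarrow}{\partial}_-&0\end{pmatrix}e-\lambda\begin{pmatrix}0&q^{-1}\overset{\leftarrow}{\partial}_+\\-\overset{\leftarrow}{\partial}_-&-\overset{\leftarrow}{\partial}_0\end{pmatrix}(1-e),$$ where $\mathrm{d}f=(f\overset{\leftarrow}{\partial}_i)\,\mathrm{d}b_i$ (sum over $i=-,0,+$).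
   Context: $q\in\mathbb{C}$ is invertible with a chosen square root, $[n;q^2]=(1-q^{2n})/(1-q^2)$; $\bar\otimes$ is the tensor product over $\mathbb{C}_q[S^2]$. $\mathbb{C}_q[SL_2]$ is the Hopf algebra generated by $a,b,c,d$ with $ba=qab$, $ca=qac$, $db=qbd$, $dc=qcd$, $bc=cb$, $ad=1+q^{-1}bc$, $da=1+qbc$. It is $\mathbb{Z}$-graded by $\deg a=\deg c=1$, $\deg b=\deg d=-1$; $\mathbb{C}_q[SL_2]_n$ is the degree $n$ component. $\mathbb{C}_q[S^2]=\mathbb{C}_q[SL_2]_0$ is generated by $b_0=bc$, $b_+=cd$, $b_-=ab$. $\Omega^1(\mathbb{C}_q[SL_2])$ is the bimodule calculus that is free as a left module on $e^+,e^-,e^0$, with $e^\pm x=q^{\deg x}x\,e^\pm$ and $e^0x=q^{2\deg x}x\,e^0$ for homogeneous $x$, and $$\mathrm{d}a=ae^0+qbe^+,\quad \mathrm{d}b=ae^--q^{-2}be^0,\quad \mathrm{d}c=ce^0+qde^+,\quad \mathrm{d}d=ce^--q^{-2}de^0.$$ $\Omega^1(\mathbb{C}_q[S^2])=\mathrm{span}\{m\,\mathrm{d}n\}=\Omega^{1,0}\oplus\Omega^{0,1}$ with $\Omega^{1,0}=\mathbb{C}_q[SL_2]_{-2}e^+$, $\Omega^{0,1}=\mathbb{C}_q[SL_2]_2e^-$. Spinors: $\mathcal{S}=\mathcal{S}_-\oplus\mathcal{S}_+$ with $\mathcal{S}_-=\mathbb{C}_q[SL_2]_1$, $\mathcal{S}_+=\mathbb{C}_q[SL_2]_{-1}$,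 viewed inside $\mathbb{C}_q[SL_2]$. The covariant derivative is $D\sigma=\mathrm{d}\sigma-[n;q^2]\sigma e^0$ for $\sigma$ of degree $n=\pm1$, regarded in $\Omega^1(\mathbb{C}_q[S^2])\bar\otimes\mathbb{C}_q[SL_2]_n$ via the injective multiplication map $\tau\bar\otimes\sigma\mapsto\tau\sigma\in\Omega^1(\mathbb{C}_q[SL_2])$. The map $\gamma:\Omega^1(\mathbb{C}_q[S^2])\bar\otimes\mathcal{S}\to\mathcal{S}$ is $\gamma(fe^+\bar\otimes\sigma)=f\sigma$ for $f\in\mathbb{C}_q[SL_2]_{-2}$, $\sigma\in\mathcal{S}_-$; $\gamma(fe^-\bar\otimes\tau)=f\tau$ for $f\in\mathbb{C}_q[SL_2]_2$, $\tau\in\mathcal{S}_+$; and zero on $\Omega^{0,1}\bar\otimes\mathcal{S}_-$ and $\Omega^{1,0}\bar\otimes\mathcal{S}_+$. The Dirac operator is $\nabla\!\!\!\!/=\gamma\circ D$. Conventions: the isomorphisms for $\mathcal{S}_\pm$ are induced by $(f,g)\mapsto fa+gc\in\mathcal{S}_-$ and $(f,g)\mapsto fb+gd\in\mathcal{S}_+$. $D$ in the trivialisation means that the covariant derivative of the spinor given by $(f,g)$ is $\big((\mathrm{d}f,\mathrm{d}g)+(f,g)((\mathrm{d}e)e-e\,\mathrm{d}e)\big)\bar\otimes\binom{a+\lambda b}{c+\lambda d}$. The symbols $\overset{\leftarrow}{\partial}_i$ act from the right and assign to $f$ the coefficients $f_i=f\overset{\leftarrow}{\partial}_i\in\mathbb{C}_q[S^2]$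 of any chosen expansion $\mathrm{d}f=f_i\,\mathrm{d}b_i$; these coefficients are not unique but the total $\nabla\!\!\!\!/$ does not depend on the choice. $\overset{\leftarrow}{\partial}_ib_i$ means $f\mapsto f_ib_i$ (summed), and a matrix $X$ of operators acts on a row vector as $(f,g)X$ with entries applied from the right, followed by right multiplication by the subsequent matrices. *)

theory Defs
  imports
    Complex_Main
    "HOL-Library.Poly_Mapping"
    "HOL-Library.Product_Plus"
    "HOL-Algebra.Ideal"
    "HOL-Algebra.Free_Abelian_Groups"
begin

datatype gen = Ga | Gb | Gc | Gd

datatype word = Word (letters: "gen list")

instantiation word :: monoid_add
begin

definition zero_word :: word where "zero_word = Word []"

definition plus_word :: "word \<Rightarrow> word \<Rightarrow> word" where
  "plus_word v w = Word (letters v @ letters w)"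

instance
  by standard (simp_all add: zero_word_def plus_word_def)

end

text \<open>Since \<open>+\<close> on words is concatenation, the convolution product that \<open>HOL-Library.Poly_Mapping\<close>
  puts on this type is the product of the free associative algebra.\<close>

type_synonym free_algebra = "word \<Rightarrow>\<^sub>0 complex"

definition X :: "gen \<Rightarrow> free_algebra" where
  "X g = Poly_Mapping.single (Word [g]) 1"

definition const :: "complex \<Rightarrow> free_algebra" where
  "const z = Poly_Mapping.single 0 z"

definition free_ring :: "free_algebra ring" where
  "free_ring = \<lparr>carrier = UNIV, mult = (*), one = 1, ring.zero = 0, add = (+)\<rparr>"

definition sl2_relators :: "complex \<Rightarrow> free_algebra set" where
  "sl2_relators q =
    {X Gb * X Ga - const q * X Ga * X Gb,
     X Gc * X Ga - const q * X Ga * X Gc,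
     X Gd * X Gb - const q * X Gb * X Gd,
     X Gd * X Gc - const q * X Gc * X Gd,
     X Gb * X Gc - X Gc * X Gb,
     X Ga * X Gd - (1 + const (inverse q) * X Gb * X Gc),
     X Gd * X Ga - (1 + const q * X Gb * X Gc)}"

fun gen_degree :: "gen \<Rightarrow> int" where
  "gen_degree Ga = 1"
| "gen_degree Gb = -1"
| "gen_degree Gc = 1"
| "gen_degree Gd = -1"

definition word_degree :: "word \<Rightarrow> int" where
  "word_degree w = (\<Sum>g\<leftarrow>letters w. gen_degree g)"

text \<open>The product, the scalar action and the bimodule actions are record components and not type
  class operations, because they depend on the complex parameter \<open>q\<close>; only the additive groups of
  the algebra \<open>'a\<close> and of the one-forms \<open>'m\<close> come from the type. Every associative algebra
  structure with that additive group is thus admitted, for each value of \<open>q\<close>.\<close>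

record 'a qsl2 =
  prd :: "'a \<Rightarrow> 'a \<Rightarrow> 'a" (infixl \<open>\<cdot>\<index>\<close> 72)
  uni :: 'a
  scal :: "complex \<Rightarrow> 'a \<Rightarrow> 'a"
  gena :: 'a
  genb :: 'a
  genc :: 'a
  gend :: 'a

record ('a, 'm) qsl2_calculus = "'a qsl2" +
  lact :: "'a \<Rightarrow> 'm \<Rightarrow> 'm" (infixr \<open>\<triangleright>\<index>\<close> 71)
  ract :: "'m \<Rightarrow> 'a \<Rightarrow> 'm" (infixl \<open>\<triangleleft>\<index>\<close> 71)
  ep :: 'm
  em :: 'm
  ez :: 'm
  dif :: "'a \<Rightarrow> 'm"

locale complex_algebra =
  fixes A :: "('a::ab_group_add, 'z) qsl2_scheme" (structure)
  assumes ring_1: "class.ring_1 (uni A) (\<cdot>) (+) 0 (-) uminus"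
    and vector_space: "vector_space (scal A)"
    and scal_left: "\<And>z x y. scal A z x \<cdot> y = scal A z (x \<cdot> y)"
    and scal_right: "\<And>z x y. x \<cdot> scal A z y = scal A z (x \<cdot> y)"

definition gen_val :: "('a, 'z) qsl2_scheme \<Rightarrow> gen \<Rightarrow> 'a" where
  "gen_val A g = (case g of Ga \<Rightarrow> gena A | Gb \<Rightarrow> genb A | Gc \<Rightarrow> genc A | Gd \<Rightarrow> gend A)"

definition word_val :: "('a, 'z) qsl2_scheme \<Rightarrow> word \<Rightarrow> 'a" where
  "word_val A w = foldr (\<lambda>g x. gen_val A g \<cdot>\<^bsub>A\<^esub> x) (letters w) (uni A)"

definition free_eval :: "('a::ab_group_add, 'z) qsl2_scheme \<Rightarrow> free_algebra \<Rightarrow> 'a" where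
  "free_eval A p = (\<Sum>w\<in>Poly_Mapping.keys p. scal A (Poly_Mapping.lookup p w) (word_val A w))"

text \<open>\<open>A\<close> is presented by the four generators and the relations: evaluation is onto, and its kernel
  is the two-sided ideal generated by the relators.\<close>

locale quantum_SL2 = complex_algebra A
  for A :: "('a::ab_group_add, 'z) qsl2_scheme" (structure) and q :: complex +
  assumes q_nonzero: "q \<noteq> 0"
    and generated: "range (free_eval A) = UNIV"
    and relations: "{p. free_eval A p = 0} = Idl\<^bsub>free_ring\<^esub> (sl2_relators q)"

definition deg_part :: "('a::ab_group_add, 'z) qsl2_scheme \<Rightarrow> int \<Rightarrow> 'a set" where
  "deg_part A n = free_eval A ` {p. \<forall>w\<in>Poly_Mapping.keys p. word_degree w = n}"

locale quantum_SL2_calculus = quantum_SL2 C q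
  for C :: "('a::ab_group_add, 'm::ab_group_add, 'z) qsl2_calculus_scheme" (structure)
    and q :: complex +
  assumes lact_add_left: "\<And>x y \<omega>. (x + y) \<triangleright> \<omega> = x \<triangleright> \<omega> + y \<triangleright> \<omega>"
    and lact_add_right: "\<And>x \<omega> \<eta>. x \<triangleright> (\<omega> + \<eta>) = x \<triangleright> \<omega> + x \<triangleright> \<eta>"
    and lact_prd: "\<And>x y \<omega>. (x \<cdot> y) \<triangleright> \<omega> = x \<triangleright> (y \<triangleright> \<omega>)"
    and lact_uni: "\<And>\<omega>. uni C \<triangleright> \<omega> = \<omega>"
    and ract_add_left: "\<And>x \<omega> \<eta>. (\<omega> + \<eta>) \<triangleleft> x = \<omega> \<triangleleft> x + \<eta> \<triangleleft> x"
    and ract_add_right: "\<And>x y \<omega>. \<omega> \<triangleleft> (x + y) = \<omega> \<triangleleft> x + \<omega> \<triangleleft> y"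
    and ract_prd: "\<And>x y \<omega>. \<omega> \<triangleleft> (x \<cdot> y) = (\<omega> \<triangleleft> x) \<triangleleft> y"
    and ract_uni: "\<And>\<omega>. \<omega> \<triangleleft> uni C = \<omega>"
    and bimodule: "\<And>x y \<omega>. (x \<triangleright> \<omega>) \<triangleleft> y = x \<triangleright> (\<omega> \<triangleleft> y)"
    and dif_add: "\<And>x y. dif C (x + y) = dif C x + dif C y"
    and dif_scal: "\<And>z x. dif C (scal C z x) = scal C z (uni C) \<triangleright> dif C x"
    and leibniz: "\<And>x y. dif C (x \<cdot> y) = dif C x \<triangleleft> y + x \<triangleright> dif C y"
    and spanned: "module.span (\<lambda>z \<omega>. scal C z (uni C) \<triangleright> \<omega>) {x \<triangleright> dif C y |x y. True} = UNIV"
    and free: "\<And>\<omega>. \<exists>!(x, y, z). \<omega> = x \<triangleright> ep C + y \<triangleright> em C + z \<triangleright> ez C"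
    and ep_comm: "\<And>n x. x \<in> deg_part C n \<Longrightarrow> ep C \<triangleleft> x = scal C (q powi n) x \<triangleright> ep C"
    and em_comm: "\<And>n x. x \<in> deg_part C n \<Longrightarrow> em C \<triangleleft> x = scal C (q powi n) x \<triangleright> em C"
    and ez_comm: "\<And>n x. x \<in> deg_part C n \<Longrightarrow> ez C \<triangleleft> x = scal C (q powi (2 * n)) x \<triangleright> ez C"
    and dif_a: "dif C (gena C) = gena C \<triangleright> ez C + scal C q (genb C) \<triangleright> ep C"
    and dif_b: "dif C (genb C) = gena C \<triangleright> em C - scal C (q powi (-2)) (genb C) \<triangleright> ez C"
    and dif_c: "dif C (genc C) = genc C \<triangleright> ez C + scal C q (gend C) \<triangleright> ep C"
    and dif_d: "dif C (gend C) = genc C \<triangleright> em C - scal C (q powi (-2)) (gend C) \<triangleright> ez C"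

definition sphere :: "('a::ab_group_add, 'z) qsl2_scheme \<Rightarrow> 'a set" where
  "sphere C = deg_part C 0"

datatype sphere_index = Minus | Zero | Plus

fun sphere_gen :: "('a, 'z) qsl2_scheme \<Rightarrow> sphere_index \<Rightarrow> 'a" where
  "sphere_gen C Minus = gena C \<cdot>\<^bsub>C\<^esub> genb C"
| "sphere_gen C Zero = genb C \<cdot>\<^bsub>C\<^esub> genc C"
| "sphere_gen C Plus = genc C \<cdot>\<^bsub>C\<^esub> gend C"

definition sphere_forms ::
    "('a::ab_group_add, 'm::ab_group_add, 'z) qsl2_calculus_scheme \<Rightarrow> 'm set" where
  "sphere_forms C = module.span (\<lambda>z \<omega>. scal C z (uni C) \<triangleright>\<^bsub>C\<^esub> \<omega>)
     {m \<triangleright>\<^bsub>C\<^esub> dif C n |m n. m \<in> sphere C \<and> n \<in> sphere C}"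

definition spinors_minus :: "('a::ab_group_add, 'z) qsl2_scheme \<Rightarrow> 'a set" where
  "spinors_minus C = deg_part C 1"

definition spinors_plus :: "('a::ab_group_add, 'z) qsl2_scheme \<Rightarrow> 'a set" where
  "spinors_plus C = deg_part C (-1)"

definition spinors :: "('a::ab_group_add, 'z) qsl2_scheme \<Rightarrow> 'a set" where
  "spinors C = {\<sigma> + \<tau> |\<sigma> \<tau>. \<sigma> \<in> spinors_minus C \<and> \<tau> \<in> spinors_plus C}"

text \<open>The two components of a spinor, in the order \<open>(minus, plus)\<close>.\<close>

definition spinor_parts :: "('a::ab_group_add, 'z) qsl2_scheme \<Rightarrow> 'a \<Rightarrow> 'a \<times> 'a" where
  "spinor_parts C s = (THE (\<sigma>, \<tau>). \<sigma> \<in> spinors_minus C \<and> \<tau> \<in> spinors_plus C \<and> s = \<sigma> + \<tau>)"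

type_synonym ('m, 'a) formal_sum = "('m \<times> 'a) \<Rightarrow>\<^sub>0 int"

definition tensor_relators ::
    "('a::ab_group_add, 'm::ab_group_add, 'z) qsl2_calculus_scheme \<Rightarrow> ('m, 'a) formal_sum set" where
  "tensor_relators C =
     {frag_of (\<omega> + \<eta>, s) - frag_of (\<omega>, s) - frag_of (\<eta>, s) |\<omega> \<eta> s.
        \<omega> \<in> sphere_forms C \<and> \<eta> \<in> sphere_forms C \<and> s \<in> spinors C}
   \<union> {frag_of (\<omega>, s + t) - frag_of (\<omega>, s) - frag_of (\<omega>, t) |\<omega> s t.
        \<omega> \<in> sphere_forms C \<and> s \<in> spinors C \<and> t \<in> spinors C}
   \<union> {frag_of (\<omega> \<triangleleft>\<^bsub>C\<^esub> f, s) - frag_of (\<omega>, f \<cdot>\<^bsub>C\<^esub> s) |\<omega> f s.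
        \<omega> \<in> sphere_forms C \<and> f \<in> sphere C \<and> s \<in> spinors C}"

definition pair_group ::
    "('a::ab_group_add, 'm::ab_group_add, 'z) qsl2_calculus_scheme \<Rightarrow> ('m, 'a) formal_sum monoid" where
  "pair_group C = free_Abelian_group (sphere_forms C \<times> spinors C)"

definition tensor ::
    "('a::ab_group_add, 'm::ab_group_add, 'z) qsl2_calculus_scheme \<Rightarrow> ('m, 'a) formal_sum set monoid" where
  "tensor C = pair_group C Mod generate (pair_group C) (tensor_relators C)"

definition pure ::
    "('a::ab_group_add, 'm::ab_group_add, 'z) qsl2_calculus_scheme \<Rightarrow> 'm \<Rightarrow> 'a \<Rightarrow> ('m, 'a) formal_sum set"
  where "pure C \<omega> s = generate (pair_group C) (tensor_relators C) #>\<^bsub>pair_group C\<^esub> frag_of (\<omega>, s)"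

text \<open>The summand of the tensor product in which the second factor has degree \<open>n\<close>.\<close>

definition tensor_part ::
    "('a::ab_group_add, 'm::ab_group_add, 'z) qsl2_calculus_scheme \<Rightarrow> int \<Rightarrow> ('m, 'a) formal_sum set set"
  where "tensor_part C n =
    generate (tensor C) {pure C \<omega> s |\<omega> s. \<omega> \<in> sphere_forms C \<and> s \<in> deg_part C n}"

text \<open>The additive map on the tensor product with value \<open>\<phi> \<omega> s\<close> on the pure tensor of \<open>\<omega>\<close> and \<open>s\<close>,
  for biadditive and balanced \<open>\<phi>\<close>: the additive extension of \<open>\<phi>\<close> to formal sums of pairs is then
  constant on each class \<open>t\<close>. The argument \<open>scale\<close> only serves to express integer multiples.\<close>

definition tensor_lift ::
    "(complex \<Rightarrow> 'b \<Rightarrow> 'b) \<Rightarrow> ('m \<Rightarrow> 'a \<Rightarrow> 'b::ab_group_add) \<Rightarrow> ('m, 'a) formal_sum set \<Rightarrow> 'b" where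
  "tensor_lift scale \<phi> t =
     the_elem ((\<lambda>u. \<Sum>(\<omega>, s)\<in>Poly_Mapping.keys u.
       scale (of_int (Poly_Mapping.lookup u (\<omega>, s))) (\<phi> \<omega> s)) ` t)"

definition tensor_mult ::
    "('a::ab_group_add, 'm::ab_group_add, 'z) qsl2_calculus_scheme \<Rightarrow> ('m, 'a) formal_sum set \<Rightarrow> 'm" where
  "tensor_mult C = tensor_lift (\<lambda>z \<omega>. scal C z (uni C) \<triangleright>\<^bsub>C\<^esub> \<omega>) (\<lambda>\<omega> s. \<omega> \<triangleleft>\<^bsub>C\<^esub> s)"

text \<open>At \<open>t = 1\<close> the quotient is to be read as its limit \<open>n\<close>; Isabelle's \<open>0 / 0 = 0\<close> would not give
  that.\<close>

definition qint :: "int \<Rightarrow> complex \<Rightarrow> complex" where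
  "qint n t = (if t = 1 then of_int n else (1 - t powi n) / (1 - t))"

definition cov_deriv_hom ::
    "('a::ab_group_add, 'm::ab_group_add, 'z) qsl2_calculus_scheme \<Rightarrow> complex \<Rightarrow> int \<Rightarrow> 'a
       \<Rightarrow> ('m, 'a) formal_sum set" where
  "cov_deriv_hom C q n \<sigma> =
     (THE t. t \<in> tensor_part C n \<and>
        tensor_mult C t = dif C \<sigma> - scal C (qint n (q\<^sup>2)) \<sigma> \<triangleright>\<^bsub>C\<^esub> ez C)"

definition cov_deriv ::
    "('a::ab_group_add, 'm::ab_group_add, 'z) qsl2_calculus_scheme \<Rightarrow> complex \<Rightarrow> 'a
       \<Rightarrow> ('m, 'a) formal_sum set" where
  "cov_deriv C q s = (case spinor_parts C s of (\<sigma>, \<tau>) \<Rightarrow>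
     cov_deriv_hom C q 1 \<sigma> \<otimes>\<^bsub>tensor C\<^esub> cov_deriv_hom C q (-1) \<tau>)"

definition coeff_ep ::
    "('a::ab_group_add, 'm::ab_group_add, 'z) qsl2_calculus_scheme \<Rightarrow> 'm \<Rightarrow> 'a" where
  "coeff_ep C \<omega> =
     (THE x. \<exists>y z. \<omega> = x \<triangleright>\<^bsub>C\<^esub> ep C + y \<triangleright>\<^bsub>C\<^esub> em C + z \<triangleright>\<^bsub>C\<^esub> ez C)"

definition coeff_em ::
    "('a::ab_group_add, 'm::ab_group_add, 'z) qsl2_calculus_scheme \<Rightarrow> 'm \<Rightarrow> 'a" where
  "coeff_em C \<omega> =
     (THE y. \<exists>x z. \<omega> = x \<triangleright>\<^bsub>C\<^esub> ep C + y \<triangleright>\<^bsub>C\<^esub> em C + z \<triangleright>\<^bsub>C\<^esub> ez C)"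

text \<open>A one-form on the sphere is \<open>f \<triangleright> ep + h \<triangleright> em\<close> with \<open>f\<close> of degree \<open>-2\<close> and \<open>h\<close> of degree \<open>2\<close>;
  \<open>ep\<close>-forms act on negative spinors only and \<open>em\<close>-forms on positive spinors only.\<close>

definition clifford_pure ::
    "('a::ab_group_add, 'm::ab_group_add, 'z) qsl2_calculus_scheme \<Rightarrow> 'm \<Rightarrow> 'a \<Rightarrow> 'a" where
  "clifford_pure C \<omega> s = (case spinor_parts C s of (\<sigma>, \<tau>) \<Rightarrow>
     coeff_ep C \<omega> \<cdot>\<^bsub>C\<^esub> \<sigma> + coeff_em C \<omega> \<cdot>\<^bsub>C\<^esub> \<tau>)"

definition clifford ::
    "('a::ab_group_add, 'm::ab_group_add, 'z) qsl2_calculus_scheme \<Rightarrow> ('m, 'a) formal_sum set \<Rightarrow> 'a" where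
  "clifford C = tensor_lift (scal C) (clifford_pure C)"

definition dirac ::
    "('a::ab_group_add, 'm::ab_group_add, 'z) qsl2_calculus_scheme \<Rightarrow> complex \<Rightarrow> 'a \<Rightarrow> 'a" where
  "dirac C q s = clifford C (cov_deriv C q s)"

type_synonym 'a mat2 = "('a \<times> 'a) \<times> ('a \<times> 'a)"

text \<open>Matrices are pairs of rows. The products take the multiplication of entries as an argument, so
  that they also apply to matrices of one-forms and to matrices of operators.\<close>

definition row_mat :: "('x \<Rightarrow> 'y \<Rightarrow> 'w::ab_group_add) \<Rightarrow> 'x \<times> 'x \<Rightarrow> 'y mat2 \<Rightarrow> 'w \<times> 'w" where
  "row_mat m v M = (case (v, M) of ((f, g), ((m11, m12), (m21, m22))) \<Rightarrow>
     (m f m11 + m g m21, m f m12 + m g m22))"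

definition mat_mat :: "('x \<Rightarrow> 'y \<Rightarrow> 'w::ab_group_add) \<Rightarrow> 'x mat2 \<Rightarrow> 'y mat2 \<Rightarrow> 'w mat2" where
  "mat_mat m L M = (row_mat m (fst L) M, row_mat m (snd L) M)"

definition map_row :: "('x \<Rightarrow> 'y) \<Rightarrow> 'x \<times> 'x \<Rightarrow> 'y \<times> 'y" where
  "map_row h = map_prod h h"

definition map_mat :: "('x \<Rightarrow> 'y) \<Rightarrow> 'x mat2 \<Rightarrow> 'y mat2" where
  "map_mat h = map_prod (map_row h) (map_row h)"

definition mat_one :: "('a::ab_group_add, 'z) qsl2_scheme \<Rightarrow> 'a mat2" where
  "mat_one C = ((uni C, 0), (0, uni C))"

definition proj_e :: "('a::ab_group_add, 'z) qsl2_scheme \<Rightarrow> complex \<Rightarrow> 'a mat2" where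
  "proj_e C q =
     ((scal C (- inverse q) (sphere_gen C Zero), scal C q (sphere_gen C Minus)),
      (- sphere_gen C Plus, uni C + scal C q (sphere_gen C Zero)))"

definition free_rows :: "('a::ab_group_add, 'z) qsl2_scheme \<Rightarrow> ('a \<times> 'a) set" where
  "free_rows C = sphere C \<times> sphere C"

definition rows_times :: "('a::ab_group_add, 'z) qsl2_scheme \<Rightarrow> 'a mat2 \<Rightarrow> ('a \<times> 'a) set" where
  "rows_times C M = (\<lambda>v. row_mat (prd C) v M) ` free_rows C"

definition sphere_module_iso ::
    "('a::ab_group_add, 'z) qsl2_scheme \<Rightarrow> ('a \<times> 'a \<Rightarrow> 'a) \<Rightarrow> ('a \<times> 'a) set \<Rightarrow> 'a set \<Rightarrow> bool" where
  "sphere_module_iso C h V W \<longleftrightarrow>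
     bij_betw h V W \<and>
     (\<forall>v\<in>V. \<forall>w\<in>V. h (v + w) = h v + h w) \<and>
     (\<forall>f\<in>sphere C. \<forall>v\<in>V. h (map_row (prd C f) v) = f \<cdot>\<^bsub>C\<^esub> h v)"

definition trivialisation ::
    "('a::ab_group_add, 'z) qsl2_scheme \<Rightarrow> complex \<Rightarrow> 'a \<times> 'a \<Rightarrow> 'a" where
  "trivialisation C l = (\<lambda>(f, g). f \<cdot>\<^bsub>C\<^esub> (gena C + scal C l (genb C)) + g \<cdot>\<^bsub>C\<^esub> (genc C + scal C l (gend C)))"

text \<open>\<open>F\<close> is a choice of coefficients of \<open>d f\<close> along the differentials of the three sphere
  generators; such a choice is not unique.\<close>

definition partials ::
    "('a::ab_group_add, 'm::ab_group_add, 'z) qsl2_calculus_scheme \<Rightarrow> 'a \<Rightarrow> (sphere_index \<Rightarrow> 'a) \<Rightarrow> bool"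
  where "partials C f F \<longleftrightarrow>
    (\<forall>i. F i \<in> sphere C) \<and>
    dif C f = (\<Sum>i\<in>{Minus, Zero, Plus}. F i \<triangleright>\<^bsub>C\<^esub> dif C (sphere_gen C i))"

end

theory Submission
  imports Defs
begin

text \<open>The matrix with columns \<open>v = (a, c)\<close> and \<open>w = (b, d)\<close> is invertible, its inverse having the
  rows \<open>x = (d, - q b)\<close> and \<open>y = (- q\<^sup>-\<^sup>1 c, a)\<close>, and \<open>e = w y\<close>, \<open>1 - e = v x\<close>. So \<open>\<sigma> \<mapsto> \<sigma> x\<close> and
  \<open>\<tau> \<mapsto> \<tau> y\<close> invert the maps onto \<open>S\<^sub>-\<close> and \<open>S\<^sub>+\<close>; the grading is a direct sum because the relators
  are homogeneous. The same expansion \<open>\<sigma> = (\<sigma> x) v\<close> shows that a tensor in \<open>\<Omega>\<^sup>1 \<otimes> S\<^sub>-\<close> is determined by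
  its product, which is the injectivity that \<open>D\<close> needs (likewise for \<open>S\<^sub>+\<close>), and by \<open>e v = 0\<close>,
  \<open>e w = w\<close> the connection \<open>(de) e - e de\<close> has the right products. All remaining identities are
  compared in the normal form that puts \<open>b\<close>, \<open>c\<close> in front of \<open>a\<close>, \<open>d\<close>.\<close>

section \<open>The grading\<close>

lemma update_eq_single_plus:
  fixes f :: "'b \<Rightarrow>\<^sub>0 'c::monoid_add"
  assumes "a \<notin> Poly_Mapping.keys f"
  shows "Poly_Mapping.update a b f = Poly_Mapping.single a b + f"
  using assms by (auto intro!: poly_mapping_eqI simp: lookup_add lookup_update lookup_single
      when_def in_keys_iff)

text \<open>The form of induction suited to additive maps: a claim about an additive map reduces to
  a single word with a coefficient, whether or not that word already occurs in
  \<open>p\<close>.\<close>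

lemma poly_mapping_plus_induct [case_names zero plus]:
  assumes "P 0" and "\<And>k c p. P p \<Longrightarrow> P (Poly_Mapping.single k c + p)"
  shows "P p"
proof (induction p rule: Poly_Mapping.update_induct)
  case (update f a b)
  with assms show ?case by (simp add: update_eq_single_plus)
qed (use assms in simp)

text \<open>Makes the ideal theory of the record-based algebra library available for the free
  algebra, whose operations come from type classes.\<close>

lemma ring_free_ring: "ring free_ring"
proof (rule ringI)
  show "abelian_group free_ring"
  proof (rule abelian_groupI)
    fix p assume "p \<in> carrier free_ring"
    show "\<exists>p'\<in>carrier free_ring. p' \<oplus>\<^bsub>free_ring\<^esub> p = \<zero>\<^bsub>free_ring\<^esub>"
      by (rule bexI [of _ "- p"]) (simp_all add: free_ring_def)
  qed (simp_all add: free_ring_def ac_simps)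
  show "monoid free_ring"
    by (rule monoidI) (simp_all add: free_ring_def mult.assoc)
qed (simp_all add: free_ring_def algebra_simps)

lemma word_degree_zero [simp]: "word_degree 0 = 0"
  by (simp add: word_degree_def zero_word_def)

lemma word_degree_Word_Nil [simp]: "word_degree (Word []) = 0"
  by (simp add: word_degree_def)

lemma word_degree_Word_Cons [simp]: "word_degree (Word (g # w)) = gen_degree g + word_degree (Word w)"
  by (simp add: word_degree_def)

lemma word_degree_plus [simp]: "word_degree (v + w) = word_degree v + word_degree w"
  by (simp add: word_degree_def plus_word_def)

section \<open>Evaluation of noncommutative polynomials in the algebra\<close>

sublocale complex_algebra \<subseteq> alg: ring_1 "uni A" "prd A" "(+)" 0 "(-)" uminus
  by (rule ring_1)

sublocale complex_algebra \<subseteq> vec: vector_space "scal A"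
  by (rule vector_space)

context complex_algebra
begin

lemmas scal_pull [simp] = scal_left scal_right

lemma word_val_zero [simp]: "word_val A 0 = uni A"
  by (simp add: word_val_def zero_word_def)

lemma word_val_Word_Nil [simp]: "word_val A (Word []) = uni A"
  by (simp add: word_val_def)

lemma word_val_Word_Cons [simp]: "word_val A (Word (g # w)) = gen_val A g \<cdot> word_val A (Word w)"
  by (simp add: word_val_def)

lemma word_val_plus [simp]: "word_val A (v + w) = word_val A v \<cdot> word_val A w"
proof -
  have "word_val A (Word xs + w) = word_val A (Word xs) \<cdot> word_val A w" for xs
    by (induction xs) (simp_all add: word_val_def plus_word_def alg.mult.assoc)
  from this [of "letters v"] show ?thesis by simp
qed

text \<open>The evaluation of the degree \<open>n\<close> component. It vanishes on the ideal of relations because each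
  relator is homogeneous, which makes the sum of the \<open>deg_part A n\<close> direct.\<close>

definition eval_deg :: "int \<Rightarrow> free_algebra \<Rightarrow> 'a" where
  "eval_deg n p = (\<Sum>w\<in>Poly_Mapping.keys p.
     if word_degree w = n then scal A (Poly_Mapping.lookup p w) (word_val A w) else 0)"

lemma eval_deg_zero [simp]: "eval_deg n 0 = 0"
  by (simp add: eval_deg_def)

lemma eval_deg_single [simp]:
  "eval_deg n (Poly_Mapping.single w c) = (if word_degree w = n then scal A c (word_val A w) else 0)"
  by (simp add: eval_deg_def)

lemma eval_deg_add: "eval_deg n (p + p') = eval_deg n p + eval_deg n p'"
  unfolding eval_deg_def
  by (rule setsum_keys_plus_distrib [where f = "\<lambda>w c. if word_degree w = n then scal A c (word_val A w) else 0"])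
    (simp_all add: vec.scale_left_distrib)

lemma eval_deg_uminus: "eval_deg n (- p) = - eval_deg n p"
  using eval_deg_add [of n p "- p"] by (simp add: eq_neg_iff_add_eq_0 add.commute)

lemma eval_deg_diff: "eval_deg n (p - p') = eval_deg n p - eval_deg n p'"
  using eval_deg_add [of n p "- p'"] by (simp add: eval_deg_uminus)

lemma free_eval_zero [simp]: "free_eval A 0 = 0"
  by (simp add: free_eval_def)

lemma free_eval_single [simp]: "free_eval A (Poly_Mapping.single w c) = scal A c (word_val A w)"
  by (simp add: free_eval_def)

lemma free_eval_add: "free_eval A (p + p') = free_eval A p + free_eval A p'"
  unfolding free_eval_def
  by (rule setsum_keys_plus_distrib [where f = "\<lambda>w c. scal A c (word_val A w)"])
    (simp_all add: vec.scale_left_distrib)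

lemma free_eval_uminus: "free_eval A (- p) = - free_eval A p"
  using free_eval_add [of p "- p"] by (simp add: eq_neg_iff_add_eq_0 add.commute)

lemma free_eval_diff: "free_eval A (p - p') = free_eval A p - free_eval A p'"
  using free_eval_add [of p "- p'"] by (simp add: free_eval_uminus)

lemma free_eval_mult: "free_eval A (p * p') = free_eval A p \<cdot> free_eval A p'"
proof (induction p rule: poly_mapping_plus_induct)
  case (plus v c p)
  have "free_eval A (Poly_Mapping.single v c * p') = scal A c (word_val A v) \<cdot> free_eval A p'"
    by (induction p' rule: poly_mapping_plus_induct)
      (simp_all add: mult_single distrib_left free_eval_add alg.distrib_left ac_simps)
  with plus show ?case by (simp add: distrib_right free_eval_add alg.distrib_right)
qed simp

lemma eval_deg_single_mult:
  "eval_deg n (Poly_Mapping.single v c * p) = scal A c (word_val A v \<cdot> eval_deg (n - word_degree v) p)"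
proof (induction p rule: poly_mapping_plus_induct)
  case (plus w d p)
  have "word_degree v + word_degree w = n \<longleftrightarrow> word_degree w = n - word_degree v" by auto
  with plus show ?case
    by (simp add: mult_single distrib_left eval_deg_add alg.distrib_left vec.scale_right_distrib)
qed simp

lemma eval_deg_mult_single:
  "eval_deg n (p * Poly_Mapping.single v c) = scal A c (eval_deg (n - word_degree v) p \<cdot> word_val A v)"
proof (induction p rule: poly_mapping_plus_induct)
  case (plus w d p)
  have "word_degree w + word_degree v = n \<longleftrightarrow> word_degree w = n - word_degree v" by auto
  with plus show ?case
    by (simp add: mult_single distrib_right eval_deg_add alg.distrib_right vec.scale_right_distrib mult.commute)
qed simp

text \<open>All \<open>n\<close> are imposed at once because multiplication by a word shifts the
  degree: the component \<open>n\<close> of a product comes from the component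
  \<open>n - word_degree v\<close> of the other factor.\<close>

lemma ideal_eval_deg_zero: "ideal {p. \<forall>n. eval_deg n p = 0} free_ring" (is "ideal ?J _")
proof (rule idealI [OF ring_free_ring])
  interpret R: ring free_ring by (rule ring_free_ring)
  show "subgroup ?J (add_monoid free_ring)"
  proof (rule R.add.subgroupI)
    fix p assume p: "p \<in> ?J"
    have "\<ominus>\<^bsub>free_ring\<^esub> p = - p"
      by (rule R.minus_equality) (simp_all add: free_ring_def)
    with p show "\<ominus>\<^bsub>free_ring\<^esub> p \<in> ?J" by (simp add: eval_deg_uminus)
  qed (auto simp: free_ring_def eval_deg_add intro: exI [of _ 0])
next
  fix p x assume p: "p \<in> ?J"
  have "eval_deg n (x * p) = 0" for n
    by (induction x arbitrary: n rule: poly_mapping_plus_induct)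
      (use p in \<open>simp_all add: distrib_right eval_deg_add eval_deg_single_mult\<close>)
  then show "x \<otimes>\<^bsub>free_ring\<^esub> p \<in> ?J" by (simp add: free_ring_def)
  have "eval_deg n (p * x) = 0" for n
    by (induction x arbitrary: n rule: poly_mapping_plus_induct)
      (use p in \<open>simp_all add: distrib_left eval_deg_add eval_deg_mult_single\<close>)
  then show "p \<otimes>\<^bsub>free_ring\<^esub> x \<in> ?J" by (simp add: free_ring_def)
qed

section \<open>Homogeneous elements of the algebra\<close>

lemma deg_part_zero [simp]: "0 \<in> deg_part A n"
  unfolding deg_part_def by (rule image_eqI [of _ _ 0]) simp_all

lemma deg_part_add [simp, intro]:
  assumes "x \<in> deg_part A n" "y \<in> deg_part A n" shows "x + y \<in> deg_part A n"
proof -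
  from assms obtain p p' where "x = free_eval A p" "y = free_eval A p'"
    and "\<forall>w\<in>Poly_Mapping.keys p. word_degree w = n" "\<forall>w\<in>Poly_Mapping.keys p'. word_degree w = n"
    by (auto simp: deg_part_def)
  then show ?thesis
    unfolding deg_part_def using Poly_Mapping.keys_add [of p p']
    by (intro image_eqI [of _ _ "p + p'"]) (auto simp: free_eval_add)
qed

lemma deg_part_word_val [simp]: "scal A c (word_val A w) \<in> deg_part A (word_degree w)"
  unfolding deg_part_def by (rule image_eqI [of _ _ "Poly_Mapping.single w c"]) auto

lemma deg_part_uni [simp]: "uni A \<in> deg_part A 0"
  using deg_part_word_val [of 1 0] by simp

lemma deg_part_induct [consumes 1, case_names zero add]:
  assumes "x \<in> deg_part A n" and "P 0"
    and "\<And>c w x. word_degree w = n \<Longrightarrow> x \<in> deg_part A n \<Longrightarrow> P x \<Longrightarrow> P (scal A c (word_val A w) + x)"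
  shows "P x"
proof -
  from assms(1) obtain p where x: "x = free_eval A p" and p: "\<forall>w\<in>Poly_Mapping.keys p. word_degree w = n"
    by (auto simp: deg_part_def)
  have "P (free_eval A p) \<and> free_eval A p \<in> deg_part A n"
    using p
  \<comment> \<open>Here the induction must add fresh words only: then no terms cancel, and the
    condition that all words have degree \<open>n\<close> passes to the smaller polynomial.\<close>
  proof (induction p rule: Poly_Mapping.update_induct)
    case const
    show ?case using assms(2) by simp
  next
    case (update f w c)
    have "Poly_Mapping.update w c f = Poly_Mapping.single w c + f"
      using update by (simp add: update_eq_single_plus)
    moreover have "Poly_Mapping.keys (Poly_Mapping.update w c f) = insert w (Poly_Mapping.keys f)"
      using update by (auto simp: in_keys_iff lookup_update split: if_splits)
    ultimately show ?case
      using update assms(3) [of w "free_eval A f" c] deg_part_add [of "scal A c (word_val A w)" n]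
        deg_part_word_val [of c w]
      by (auto simp: free_eval_add)
  qed
  with x show ?thesis by simp
qed

lemma deg_part_scal [simp, intro]:
  assumes "x \<in> deg_part A n" shows "scal A c x \<in> deg_part A n"
  using assms
proof (induction rule: deg_part_induct)
  case (add d w x)
  then show ?case
    using deg_part_add [OF _ add(3)] deg_part_word_val [of "c * d" w] by (simp add: vec.scale_right_distrib)
qed simp

lemma deg_part_uminus [simp, intro]: "x \<in> deg_part A n \<Longrightarrow> - x \<in> deg_part A n"
  using deg_part_scal [of x n "-1"] by simp

lemma deg_part_diff [simp, intro]: "x \<in> deg_part A n \<Longrightarrow> y \<in> deg_part A n \<Longrightarrow> x - y \<in> deg_part A n"
  using deg_part_add [of x n "- y"] by auto

lemma deg_part_mult:
  assumes "x \<in> deg_part A m" "y \<in> deg_part A n" shows "x \<cdot> y \<in> deg_part A (m + n)"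
  using assms(1)
proof (induction rule: deg_part_induct)
  case (add c v x)
  have "scal A c (word_val A v) \<cdot> y \<in> deg_part A (m + n)"
    using assms(2)
  proof (induction rule: deg_part_induct)
    case (add d w y)
    then show ?case
      using deg_part_add [OF _ add(3)] deg_part_word_val [of "c * d" "v + w"] \<open>word_degree v = m\<close>
      by (simp add: alg.distrib_left vec.scale_right_distrib mult.commute)
  qed simp
  with add show ?case by (auto simp: alg.distrib_right)
qed simp

lemma deg_part_multI:
  "x \<in> deg_part A m \<Longrightarrow> y \<in> deg_part A n \<Longrightarrow> m + n = k \<Longrightarrow> x \<cdot> y \<in> deg_part A k"
  using deg_part_mult by blast

lemma deg_part_gen_val: "gen_val A g \<in> deg_part A (gen_degree g)"
  using deg_part_word_val [of 1 "Word [g]"] by simp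

lemma deg_part_gens [simp]:
  "gena A \<in> deg_part A 1" "genb A \<in> deg_part A (-1)"
  "genc A \<in> deg_part A 1" "gend A \<in> deg_part A (-1)"
  using deg_part_gen_val [of Ga] deg_part_gen_val [of Gb] deg_part_gen_val [of Gc] deg_part_gen_val [of Gd]
  by (simp_all add: gen_val_def)

text \<open>The degree \<open>n\<close> of the product is the variable, so the simplifier can strip
  generators off the right end of a left-associated product; this is why later degree checks reverse
  \<open>alg.mult.assoc\<close>.\<close>

lemma deg_part_mult_gen [simp]:
  "x \<in> deg_part A (n - 1) \<Longrightarrow> x \<cdot> gena A \<in> deg_part A n"
  "x \<in> deg_part A (n + 1) \<Longrightarrow> x \<cdot> genb A \<in> deg_part A n"
  "x \<in> deg_part A (n - 1) \<Longrightarrow> x \<cdot> genc A \<in> deg_part A n"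
  "x \<in> deg_part A (n + 1) \<Longrightarrow> x \<cdot> gend A \<in> deg_part A n"
  using deg_part_mult [of x "n - 1" "gena A" 1] deg_part_mult [of x "n + 1" "genb A" "-1"]
    deg_part_mult [of x "n - 1" "genc A" 1] deg_part_mult [of x "n + 1" "gend A" "-1"] by simp_all

end

section \<open>The defining relations and directness of the grading\<close>

context quantum_SL2
begin

lemma free_eval_relator:
  assumes "p \<in> sl2_relators q" shows "free_eval A p = 0"
proof -
  interpret R: ring free_ring by (rule ring_free_ring)
  have "sl2_relators q \<subseteq> Idl\<^bsub>free_ring\<^esub> (sl2_relators q)"
    by (rule R.genideal_self) (simp add: free_ring_def)
  with assms relations show ?thesis by auto
qed

lemma free_eval_X [simp]: "free_eval A (X g) = gen_val A g"
  by (simp add: X_def)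

lemma free_eval_const [simp]: "free_eval A (const c) = scal A c (uni A)"
  by (simp add: const_def)

lemma free_eval_one [simp]: "free_eval A 1 = uni A"
  using free_eval_const [of 1] unfolding const_def by (simp add: single_one)

lemma gen_relations:
  "genb A \<cdot> gena A = scal A q (gena A \<cdot> genb A)"
  "genc A \<cdot> gena A = scal A q (gena A \<cdot> genc A)"
  "gend A \<cdot> genb A = scal A q (genb A \<cdot> gend A)"
  "gend A \<cdot> genc A = scal A q (genc A \<cdot> gend A)"
  "genb A \<cdot> genc A = genc A \<cdot> genb A"
  "gena A \<cdot> gend A = uni A + scal A (inverse q) (genb A \<cdot> genc A)"
  "gend A \<cdot> gena A = uni A + scal A q (genb A \<cdot> genc A)"
proof -
  have "\<forall>p\<in>sl2_relators q. free_eval A p = 0"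
    by (simp add: free_eval_relator)
  then show
    "genb A \<cdot> gena A = scal A q (gena A \<cdot> genb A)"
    "genc A \<cdot> gena A = scal A q (gena A \<cdot> genc A)"
    "gend A \<cdot> genb A = scal A q (genb A \<cdot> gend A)"
    "gend A \<cdot> genc A = scal A q (genc A \<cdot> gend A)"
    "genb A \<cdot> genc A = genc A \<cdot> genb A"
    "gena A \<cdot> gend A = uni A + scal A (inverse q) (genb A \<cdot> genc A)"
    "gend A \<cdot> gena A = uni A + scal A q (genb A \<cdot> genc A)"
    by (simp_all add: sl2_relators_def free_eval_diff free_eval_add free_eval_mult gen_val_def)
qed

lemma eval_deg_relator:
  assumes "p \<in> sl2_relators q" shows "eval_deg n p = 0"
proof -
  \<comment> \<open>The unit is the empty word, of degree 0. Written in this way, it lets every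
    relator be evaluated word by word: its words share one degree, so \<open>eval_deg\<close>
    returns either the whole relation or 0.\<close>
  have one: "(1 :: free_algebra) = Poly_Mapping.single 0 1" by simp
  from assms show ?thesis
    using gen_relations
    by (auto simp: sl2_relators_def X_def const_def mult_single eval_deg_diff eval_deg_add one gen_val_def
        simp del: single_one)
qed

text \<open>The kernel of evaluation is the smallest ideal containing the relators, hence lies
  inside the ideal of polynomials whose components all evaluate to 0. So a homogeneous component
  depends only on the element represented.\<close>

lemma eval_deg_eq_zero:
  assumes "free_eval A p = 0" shows "eval_deg n p = 0"
proof -
  interpret R: ring free_ring by (rule ring_free_ring)
  have "Idl\<^bsub>free_ring\<^esub> (sl2_relators q) \<subseteq> {p. \<forall>n. eval_deg n p = 0}"
    by (rule R.genideal_minimal [OF ideal_eval_deg_zero]) (auto simp: eval_deg_relator)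
  with assms relations show ?thesis by auto
qed

lemma deg_part_disjoint:
  assumes "x \<in> deg_part A m" "x \<in> deg_part A n" "m \<noteq> n" shows "x = 0"
proof -
  from assms obtain p p' where x: "x = free_eval A p" "x = free_eval A p'"
    and p: "\<forall>w\<in>Poly_Mapping.keys p. word_degree w = m" "\<forall>w\<in>Poly_Mapping.keys p'. word_degree w = n"
    unfolding deg_part_def by blast
  have "eval_deg m (p - p') = 0"
    by (rule eval_deg_eq_zero) (use x in \<open>simp add: free_eval_diff\<close>)
  \<comment> \<open>The component of degree \<open>m\<close> is all of \<open>p\<close> and nothing
    of \<open>p'\<close>.\<close>
  moreover have "eval_deg m p = x" "eval_deg m p' = 0"
    using p assms(3) x by (simp_all add: eval_deg_def free_eval_def)
  ultimately show ?thesis by (simp add: eval_deg_diff)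
qed

section \<open>The modules of spinors\<close>

text \<open>Extends a rewrite rule for two adjacent factors to right-associated products, where the
  second factor is followed by further ones.\<close>

lemma prd_rewrite: "x \<cdot> y = w \<Longrightarrow> x \<cdot> (y \<cdot> z) = w \<cdot> z"
  by (simp flip: alg.mult.assoc)

lemma ba_reversed: "gena A \<cdot> genb A = scal A (inverse q) (genb A \<cdot> gena A)"
  and ca_reversed: "gena A \<cdot> genc A = scal A (inverse q) (genc A \<cdot> gena A)"
  using q_nonzero by (simp_all add: gen_relations)

text \<open>The relations oriented for rewriting: \<open>b\<close> and \<open>c\<close> move to the
  left of \<open>a\<close> and \<open>d\<close>, \<open>b\<close> to the left of \<open>c\<close>,
  and an adjacent pair of \<open>a\<close> and \<open>d\<close> is eliminated in favour of
  \<open>b\<close> and \<open>c\<close>.\<close>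

lemmas pbw_pairs =
  ba_reversed ca_reversed gen_relations(3,4) gen_relations(5) [symmetric] gen_relations(6,7)

lemmas pbw = pbw_pairs pbw_pairs [THEN prd_rewrite] alg.mult.assoc alg.distrib_left alg.distrib_right
  alg.left_diff_distrib alg.right_diff_distrib vec.scale_right_distrib vec.scale_right_diff_distrib

lemma deg_part_sphere_gen [simp]: "sphere_gen A i \<in> deg_part A 0"
  by (cases i) simp_all

text \<open>The factorisation \<open>1 - e = v x\<close> applied to a row: the row enters only
  through its image in the negative spinors. The next lemma does the same with
  \<open>e = w y\<close>.\<close>

lemma row_times_one_minus_proj:
  "row_mat (prd A) (f, g) (mat_one A - proj_e A q) =
     ((f \<cdot> gena A + g \<cdot> genc A) \<cdot> gend A, - scal A q ((f \<cdot> gena A + g \<cdot> genc A) \<cdot> genb A))"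
  using q_nonzero by (simp add: row_mat_def mat_one_def proj_e_def pbw)

lemma row_times_proj:
  "row_mat (prd A) (f, g) (proj_e A q) =
     (- scal A (inverse q) ((f \<cdot> genb A + g \<cdot> gend A) \<cdot> genc A), (f \<cdot> genb A + g \<cdot> gend A) \<cdot> gena A)"
  using q_nonzero by (simp add: row_mat_def proj_e_def pbw)

text \<open>This is \<open>x v = 1\<close> multiplied by \<sigma> on the left. The three lemmas that
  follow are \<open>y w = 1\<close>, \<open>x w = 0\<close> and \<open>y v = 0\<close>; together
  they say that the rows \<open>x\<close>, \<open>y\<close> form a left inverse of the matrix with
  columns \<open>v\<close>, \<open>w\<close>.\<close>

lemma minus_expand:
  "(\<sigma> \<cdot> gend A) \<cdot> gena A + (- scal A q (\<sigma> \<cdot> genb A)) \<cdot> genc A = \<sigma>"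
  using q_nonzero by (simp add: pbw)

lemma plus_expand:
  "(- scal A (inverse q) (\<tau> \<cdot> genc A)) \<cdot> genb A + (\<tau> \<cdot> gena A) \<cdot> gend A = \<tau>"
  using q_nonzero by (simp add: pbw)

lemma minus_expand_plus:
  "(\<sigma> \<cdot> gend A) \<cdot> genb A + (- scal A q (\<sigma> \<cdot> genb A)) \<cdot> gend A = 0"
  using q_nonzero by (simp add: pbw)

lemma plus_expand_minus:
  "(- scal A (inverse q) (\<tau> \<cdot> genc A)) \<cdot> gena A + (\<tau> \<cdot> gena A) \<cdot> genc A = 0"
  using q_nonzero by (simp add: pbw)

text \<open>A linear map with a right inverse \<open>s\<close> is bijective from the image of
  \<open>s\<close> onto its target, with inverse \<open>s\<close>. In the three uses that image is
  the range of \<open>1 - e\<close>, the range of \<open>e\<close> and the whole free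
  module.\<close>

lemma sphere_module_iso_splitting:
  assumes h: "\<And>v w. h (v + w) = h v + h w" "\<And>f v. h (map_row (prd A f) v) = f \<cdot> h v"
    and h_mem: "\<And>v. v \<in> free_rows A \<Longrightarrow> h v \<in> W"
    and s_mem: "\<And>w. w \<in> W \<Longrightarrow> s w \<in> free_rows A"
    and hs: "\<And>w. w \<in> W \<Longrightarrow> h (s w) = w"
    and V: "V = s ` W"
  shows "sphere_module_iso A h V W"
  unfolding sphere_module_iso_def
proof (intro conjI ballI h)
  show "bij_betw h V W"
    by (rule bij_betw_byWitness [where f' = s]) (auto simp: V hs)
qed

text \<open>Right multiplication by \<open>M\<close> factors as \<open>s\<close> after
  \<open>h\<close>, and \<open>h\<close> is onto \<open>W\<close> because \<open>s\<close> is a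
  right inverse.\<close>

lemma rows_times_eq_image:
  assumes "\<And>v. row_mat (prd A) v M = s (h v)" and "\<And>v. v \<in> free_rows A \<Longrightarrow> h v \<in> W"
    and "\<And>w. w \<in> W \<Longrightarrow> s w \<in> free_rows A" "\<And>w. w \<in> W \<Longrightarrow> h (s w) = w"
  shows "rows_times A M = s ` W"
proof
  show "rows_times A M \<subseteq> s ` W"
    using assms(1,2) by (auto simp: rows_times_def)
  show "s ` W \<subseteq> rows_times A M"
  proof
    fix x assume "x \<in> s ` W"
    then obtain w where w: "w \<in> W" "x = s w" by blast
    with assms have "x = row_mat (prd A) (s w) M" by simp
    with w assms(3) show "x \<in> rows_times A M" unfolding rows_times_def by blast
  qed
qed

lemma spinors_minus_iso:
  "sphere_module_iso A (\<lambda>(f, g). f \<cdot> gena A + g \<cdot> genc A) (rows_times A (mat_one A - proj_e A q)) (spinors_minus A)"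
  (is "sphere_module_iso A ?h _ _")
proof -
  let ?s = "\<lambda>\<sigma>. (\<sigma> \<cdot> gend A, - scal A q (\<sigma> \<cdot> genb A))"
  have h: "?h v \<in> spinors_minus A" if "v \<in> free_rows A" for v
    using that by (auto simp: free_rows_def sphere_def spinors_minus_def)
  have s: "?s \<sigma> \<in> free_rows A" if "\<sigma> \<in> spinors_minus A" for \<sigma>
    using that by (auto simp: free_rows_def sphere_def spinors_minus_def)
  have hs: "?h (?s \<sigma>) = \<sigma>" for \<sigma>
    using minus_expand by simp
  have rows: "rows_times A (mat_one A - proj_e A q) = ?s ` spinors_minus A"
    by (rule rows_times_eq_image [where h = ?h]) (use h s hs in \<open>auto simp: row_times_one_minus_proj\<close>)
  show ?thesis
    by (rule sphere_module_iso_splitting [where s = ?s, OF _ _ h s hs rows])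
      (auto simp: map_row_def alg.distrib_left alg.distrib_right alg.mult.assoc)
qed

lemma spinors_plus_iso:
  "sphere_module_iso A (\<lambda>(f, g). f \<cdot> genb A + g \<cdot> gend A) (rows_times A (proj_e A q)) (spinors_plus A)"
  (is "sphere_module_iso A ?h _ _")
proof -
  let ?s = "\<lambda>\<tau>. (- scal A (inverse q) (\<tau> \<cdot> genc A), \<tau> \<cdot> gena A)"
  have h: "?h v \<in> spinors_plus A" if "v \<in> free_rows A" for v
    using that by (auto simp: free_rows_def sphere_def spinors_plus_def)
  have s: "?s \<tau> \<in> free_rows A" if "\<tau> \<in> spinors_plus A" for \<tau>
    using that by (auto simp: free_rows_def sphere_def spinors_plus_def)
  have hs: "?h (?s \<tau>) = \<tau>" for \<tau>
    using plus_expand by simp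
  have rows: "rows_times A (proj_e A q) = ?s ` spinors_plus A"
    by (rule rows_times_eq_image [where h = ?h]) (use h s hs in \<open>auto simp: row_times_proj\<close>)
  show ?thesis
    by (rule sphere_module_iso_splitting [where s = ?s, OF _ _ h s hs rows])
      (auto simp: map_row_def alg.distrib_left alg.distrib_right alg.mult.assoc)
qed

text \<open>Uniqueness in the definite description is directness of the grading: the difference of
  two choices has degree 1 and degree -1 at the same time.\<close>

lemma spinor_parts_add:
  assumes "\<sigma> \<in> deg_part A 1" "\<tau> \<in> deg_part A (-1)"
  shows "spinor_parts A (\<sigma> + \<tau>) = (\<sigma>, \<tau>)"
  unfolding spinor_parts_def spinors_minus_def spinors_plus_def
proof (rule the_equality)
  fix p assume "case p of (\<sigma>', \<tau>') \<Rightarrow> \<sigma>' \<in> deg_part A 1 \<and> \<tau>' \<in> deg_part A (-1) \<and> \<sigma> + \<tau> = \<sigma>' + \<tau>'"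
  then obtain \<sigma>' \<tau>' where p: "p = (\<sigma>', \<tau>')" and mem: "\<sigma>' \<in> deg_part A 1" "\<tau>' \<in> deg_part A (-1)"
    and eq: "\<sigma> - \<sigma>' = \<tau>' - \<tau>" by (auto simp: algebra_simps)
  have "\<sigma> - \<sigma>' \<in> deg_part A 1"
    using assms mem by (intro deg_part_diff)
  moreover have "\<sigma> - \<sigma>' \<in> deg_part A (-1)"
    unfolding eq using assms mem by (intro deg_part_diff)
  ultimately have "\<sigma> - \<sigma>' = 0" by (rule deg_part_disjoint) simp
  with eq p show "p = (\<sigma>, \<tau>)" by simp
qed (use assms in simp)

lemma spinorsE:
  assumes "s \<in> spinors A"
  obtains \<sigma> \<tau> where "s = \<sigma> + \<tau>" "\<sigma> \<in> deg_part A 1" "\<tau> \<in> deg_part A (-1)"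
  using assms by (auto simp: spinors_def spinors_minus_def spinors_plus_def)

lemma spinors_addI: "\<sigma> \<in> deg_part A 1 \<Longrightarrow> \<tau> \<in> deg_part A (-1) \<Longrightarrow> \<sigma> + \<tau> \<in> spinors A"
  by (auto simp: spinors_def spinors_minus_def spinors_plus_def)

lemma deg_part_spinors:
  "\<sigma> \<in> deg_part A 1 \<Longrightarrow> \<sigma> \<in> spinors A" "\<tau> \<in> deg_part A (-1) \<Longrightarrow> \<tau> \<in> spinors A"
  using spinors_addI [of \<sigma> 0] spinors_addI [of 0 \<tau>] by simp_all

lemma trivialisation_eq:
  "trivialisation A l (f, g) = (f \<cdot> gena A + g \<cdot> genc A) + scal A l (f \<cdot> genb A + g \<cdot> gend A)"
  by (simp add: trivialisation_def alg.distrib_left vec.scale_right_distrib)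

lemma trivialisation_iso:
  assumes l: "l \<noteq> 0"
  shows "sphere_module_iso A (trivialisation A l) (free_rows A) (spinors A)"
proof -
  let ?h = "trivialisation A l"
  \<comment> \<open>The inverse map sends \<sigma> + \<tau> to the row \<sigma> \<open>x\<close> +
    \<open>inverse l\<close> \<tau> \<open>y\<close>.\<close>
  define s where "s w = (case spinor_parts A w of (\<sigma>, \<tau>) \<Rightarrow>
     (\<sigma> \<cdot> gend A - scal A (inverse l * inverse q) (\<tau> \<cdot> genc A),
      - scal A q (\<sigma> \<cdot> genb A) + scal A (inverse l) (\<tau> \<cdot> gena A)))" for w
  have hs: "?h (s w) = w" and s: "s w \<in> free_rows A" if w: "w \<in> spinors A" for w
  proof -
    from w obtain \<sigma> \<tau> where *: "w = \<sigma> + \<tau>" "\<sigma> \<in> deg_part A 1" "\<tau> \<in> deg_part A (-1)"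
      by (rule spinorsE)
    show "?h (s w) = w"
      using q_nonzero l * by (simp add: s_def spinor_parts_add trivialisation_eq pbw)
    show "s w \<in> free_rows A"
      using * by (auto simp: s_def spinor_parts_add free_rows_def sphere_def
          intro!: deg_part_diff deg_part_add deg_part_uminus deg_part_scal)
  qed
  have h: "?h v \<in> spinors A" if "v \<in> free_rows A" for v
    using that by (cases v) (auto simp: free_rows_def sphere_def trivialisation_eq intro!: spinors_addI)
  \<comment> \<open>The opposite composite amounts to \<open>v x + w y = (1 - e) + e = 1\<close>,
    with \<open>v\<close> the column here; it shows that \<open>s\<close> reaches every row.\<close>
  have sh: "s (?h v) = v" if "v \<in> free_rows A" for v
  proof (cases v)
    case (Pair f g)
    with that have "f \<in> deg_part A 0" "g \<in> deg_part A 0" by (auto simp: free_rows_def sphere_def)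
    then have "spinor_parts A (?h v) = (f \<cdot> gena A + g \<cdot> genc A, scal A l (f \<cdot> genb A + g \<cdot> gend A))"
      unfolding Pair trivialisation_eq by (intro spinor_parts_add) auto
    moreover have "inverse l * inverse q * l = inverse q" "inverse l * inverse q * (l * q) = 1"
      using l q_nonzero by (simp_all add: field_simps)
    ultimately show ?thesis using q_nonzero l Pair by (simp add: s_def pbw)
  qed
  have rows: "free_rows A = s ` spinors A"
  proof
    show "free_rows A \<subseteq> s ` spinors A"
      using h sh by (metis image_eqI subsetI)
    show "s ` spinors A \<subseteq> free_rows A"
      using s by blast
  qed
  show ?thesis
  proof (rule sphere_module_iso_splitting [where s = s, OF _ _ h s hs rows])
    show "?h (v + w) = ?h v + ?h w" for v w
      by (cases v; cases w) (simp add: trivialisation_def alg.distrib_right)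
    show "?h (map_row (prd A f) v) = f \<cdot> ?h v" for f v
      by (cases v) (simp add: trivialisation_def map_row_def alg.distrib_left alg.mult.assoc)
  qed
qed

end

section \<open>One-forms\<close>

lemma qint_zero [simp]: "qint 0 t = 0"
  by (simp add: qint_def)

text \<open>The recursion that the Leibniz rule produces in the \<open>ez\<close> coefficient when a
  generator of degree 1 is put in front; the next lemma serves the generators of degree -1.\<close>

lemma qint_plus_one:
  assumes "t \<noteq> 0" shows "qint (n + 1) t = t powi n + qint n t"
proof (cases "t = 1")
  case False
  then have "1 - t \<noteq> 0" by simp
  with assms False show ?thesis by (simp add: qint_def power_int_add field_simps)
qed (simp add: qint_def)

lemma qint_minus_one:
  assumes "t \<noteq> 0" shows "qint (n - 1) t = - (t powi (n - 1)) + qint n t"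
  using qint_plus_one [OF assms, of "n - 1"] by simp

lemma (in quantum_SL2) q_cancel:
  "q * inverse q = 1" "inverse q * q = 1" "q * (inverse q * z) = z" "inverse q * (q * z) = z"
  using q_nonzero by simp_all

lemmas (in quantum_SL2) q_simps = q_cancel mult.assoc mult.commute mult.left_commute

context quantum_SL2_calculus
begin

text \<open>Coordinates in the left basis \<open>ep\<close>, \<open>em\<close>, \<open>ez\<close>:
  by freeness an equation of one-forms becomes three equations in the algebra.\<close>

definition form :: "'a \<Rightarrow> 'a \<Rightarrow> 'a \<Rightarrow> 'm" where
  "form x y z = x \<triangleright> ep C + y \<triangleright> em C + z \<triangleright> ez C"

lemma lact_zero_left [simp]: "0 \<triangleright> \<omega> = 0"
  using lact_add_left [of 0 0 \<omega>] by simp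

lemma lact_minus_left: "(- x) \<triangleright> \<omega> = - (x \<triangleright> \<omega>)"
  using lact_add_left [of x "- x" \<omega>] by (simp add: eq_neg_iff_add_eq_0 add.commute)

lemma form_exists: "\<exists>x y z. \<omega> = form x y z"
  using free [of \<omega>] by (auto simp: form_def)

lemma formE:
  obtains x y z where "\<omega> = form x y z"
  using form_exists by blast

lemma form_eq_iff [simp]: "form x y z = form x' y' z' \<longleftrightarrow> x = x' \<and> y = y' \<and> z = z'"
proof
  assume "form x y z = form x' y' z'"
  then have "(case (x, y, z) of (u, v, w) \<Rightarrow> form x y z = u \<triangleright> ep C + v \<triangleright> em C + w \<triangleright> ez C)"
    and "(case (x', y', z') of (u, v, w) \<Rightarrow> form x y z = u \<triangleright> ep C + v \<triangleright> em C + w \<triangleright> ez C)"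
    by (simp_all add: form_def)
  with free [of "form x y z"] have "(x, y, z) = (x', y', z')" by blast
  then show "x = x' \<and> y = y' \<and> z = z'" by simp
qed simp

lemma coeff_form [simp]: "coeff_ep C (form x y z) = x" "coeff_em C (form x y z) = y"
  unfolding coeff_ep_def coeff_em_def form_def [symmetric] by auto

lemma form_add [simp]: "form x y z + form x' y' z' = form (x + x') (y + y') (z + z')"
  by (simp add: form_def lact_add_left)

lemma form_zero: "0 = form 0 0 0"
  by (simp add: form_def)

lemma form_minus [simp]: "- form x y z = form (- x) (- y) (- z)"
  by (simp add: form_def lact_minus_left)

lemma form_diff [simp]: "form x y z - form x' y' z' = form (x - x') (y - y') (z - z')"
  using form_add [of x y z "- x'" "- y'" "- z'"] by (simp flip: form_minus)

lemma lact_form [simp]: "x \<triangleright> form u v w = form (x \<cdot> u) (x \<cdot> v) (x \<cdot> w)"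
  by (simp add: form_def lact_add_right lact_prd)

lemma ez_form: "x \<triangleright> ez C = form 0 0 x"
  by (simp add: form_def)

lemma ract_form:
  assumes "x \<in> deg_part C n"
  shows "form u v w \<triangleleft> x =
    form (scal C (q powi n) (u \<cdot> x)) (scal C (q powi n) (v \<cdot> x)) (scal C (q powi (2 * n)) (w \<cdot> x))"
  by (simp add: form_def ract_add_left bimodule ep_comm [OF assms] em_comm [OF assms] ez_comm [OF assms]
      flip: lact_prd)

lemma ract_form_deg0:
  assumes "x \<in> deg_part C 0" shows "form u v w \<triangleleft> x = form (u \<cdot> x) (v \<cdot> x) (w \<cdot> x)"
  using ract_form [OF assms] by simp

lemma ract_form_gens:
  "form u v w \<triangleleft> gena C = form (scal C q (u \<cdot> gena C)) (scal C q (v \<cdot> gena C)) (scal C (q\<^sup>2) (w \<cdot> gena C))"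
  "form u v w \<triangleleft> genc C = form (scal C q (u \<cdot> genc C)) (scal C q (v \<cdot> genc C)) (scal C (q\<^sup>2) (w \<cdot> genc C))"
  "form u v w \<triangleleft> genb C = form (scal C (inverse q) (u \<cdot> genb C)) (scal C (inverse q) (v \<cdot> genb C))
     (scal C (inverse q ^ 2) (w \<cdot> genb C))"
  "form u v w \<triangleleft> gend C = form (scal C (inverse q) (u \<cdot> gend C)) (scal C (inverse q) (v \<cdot> gend C))
     (scal C (inverse q ^ 2) (w \<cdot> gend C))"
  by (simp_all add: ract_form [where n = 1] ract_form [where n = "-1"] power_int_minus power_inverse)

lemma dif_gens:
  "dif C (gena C) = form (scal C q (genb C)) 0 (gena C)"
  "dif C (genb C) = form 0 (gena C) (- scal C (inverse q ^ 2) (genb C))"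
  "dif C (genc C) = form (scal C q (gend C)) 0 (genc C)"
  "dif C (gend C) = form 0 (genc C) (- scal C (inverse q ^ 2) (gend C))"
  by (simp_all add: form_def dif_a dif_b dif_c dif_d lact_minus_left power_int_minus power_inverse add.commute)

lemma dif_zero [simp]: "dif C 0 = 0"
  using dif_add [of 0 0] by simp

lemma dif_uni [simp]: "dif C (uni C) = 0"
  using leibniz [of "uni C" "uni C"] by (simp add: lact_uni ract_uni)

text \<open>The \<open>ez\<close> terms of the two factors cancel, since one factor has degree 1 and
  the other -1. What remains is quadratic in \<open>(b, d)\<close> along \<open>ep\<close> and in
  \<open>(a, c)\<close> along \<open>em\<close>.\<close>

lemma dif_sphere_gen:
  "dif C (sphere_gen C Minus) = form (genb C \<cdot> genb C) (gena C \<cdot> gena C) 0"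
  "dif C (sphere_gen C Zero) = form (scal C q (genb C \<cdot> gend C)) (scal C q (gena C \<cdot> genc C)) 0"
  "dif C (sphere_gen C Plus) = form (gend C \<cdot> gend C) (genc C \<cdot> genc C) 0"
  by (simp_all only: sphere_gen.simps leibniz dif_gens ract_form_gens lact_form form_add)
    (simp_all add: pbw power2_eq_square q_simps)

text \<open>Induction on the letters with the Leibniz rule. The \<open>ez\<close> coefficient is
  exactly the term that the covariant derivative subtracts, and it vanishes in degree 0; the two
  other coefficients have their degree shifted by -2 and 2.\<close>

lemma dif_word_val:
  "\<exists>u\<in>deg_part C (word_degree w - 2). \<exists>v\<in>deg_part C (word_degree w + 2).
     dif C (word_val C w) = form u v (scal C (qint (word_degree w) (q\<^sup>2)) (word_val C w))"
proof -
  have "\<exists>u\<in>deg_part C (word_degree (Word xs) - 2). \<exists>v\<in>deg_part C (word_degree (Word xs) + 2).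
     dif C (word_val C (Word xs)) = form u v (scal C (qint (word_degree (Word xs)) (q\<^sup>2)) (word_val C (Word xs)))"
    for xs
  proof (induction xs)
    case Nil
    show ?case by (auto simp: form_zero intro!: bexI [of _ 0])
  next
    case (Cons g xs)
    define n x where "n = word_degree (Word xs)" and "x = word_val C (Word xs)"
    have x: "x \<in> deg_part C n" using deg_part_word_val [of 1 "Word xs"] by (simp add: x_def n_def)
    from Cons obtain u v where uv: "u \<in> deg_part C (n - 2)" "v \<in> deg_part C (n + 2)"
      and dx: "dif C x = form u v (scal C (qint n (q\<^sup>2)) x)" by (auto simp: n_def x_def)
    have t: "q\<^sup>2 \<noteq> 0" using q_nonzero by simp
    \<comment> \<open>Moving \<open>x\<close> past \<open>ez\<close> gives
      \<open>q powi (2 * n)\<close>; the extra factor \<open>inverse q ^ 2\<close> is the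
      coefficient in \<open>db\<close> and \<open>dd\<close>.\<close>
    have powi: "(q\<^sup>2) powi n = q powi (2 * n)" "(q\<^sup>2) powi (n - 1) = q powi (2 * n) * inverse q ^ 2"
      using power_int_mult [of q 2 n] t by (simp_all add: power_int_diff field_simps)
    note simps = leibniz dx ract_form [OF x] dif_gens gen_val_def qint_plus_one [OF t] qint_minus_one [OF t]
      powi vec.scale_left_distrib vec.scale_left_diff_distrib
    have "\<exists>u'\<in>deg_part C (n + gen_degree g - 2). \<exists>v'\<in>deg_part C (n + gen_degree g + 2).
      dif C (gen_val C g \<cdot> x) = form u' v' (scal C (qint (n + gen_degree g) (q\<^sup>2)) (gen_val C g \<cdot> x))"
    \<comment> \<open>In each case the witnesses are the \<open>ep\<close> and \<open>em\<close>
      coefficients of \<open>dg \<triangleleft> x + g \<triangleright> dx\<close>; \<open>da\<close>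
      and \<open>dc\<close> contribute to \<open>ep\<close>, \<open>db\<close> and \<open>dd\<close>
      to \<open>em\<close>.\<close>
    proof (cases g)
      case Ga
      show ?thesis
        unfolding Ga
        by (rule bexI [of _ "scal C (q powi n) (scal C q (genb C) \<cdot> x) + gena C \<cdot> u"],
            rule bexI [of _ "gena C \<cdot> v"])
          (use x uv in \<open>auto simp: simps intro!: deg_part_add deg_part_scal
            deg_part_multI [OF deg_part_gens(1)] deg_part_multI [OF deg_part_gens(2)]\<close>)
    next
      case Gb
      show ?thesis
        unfolding Gb
        by (rule bexI [of _ "genb C \<cdot> u"], rule bexI [of _ "scal C (q powi n) (gena C \<cdot> x) + genb C \<cdot> v"])
          (use x uv in \<open>auto simp: simps intro!: deg_part_add deg_part_scal
            deg_part_multI [OF deg_part_gens(1)] deg_part_multI [OF deg_part_gens(2)]\<close>)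
    next
      case Gc
      show ?thesis
        unfolding Gc
        by (rule bexI [of _ "scal C (q powi n) (scal C q (gend C) \<cdot> x) + genc C \<cdot> u"],
            rule bexI [of _ "genc C \<cdot> v"])
          (use x uv in \<open>auto simp: simps intro!: deg_part_add deg_part_scal
            deg_part_multI [OF deg_part_gens(3)] deg_part_multI [OF deg_part_gens(4)]\<close>)
    next
      case Gd
      show ?thesis
        unfolding Gd
        by (rule bexI [of _ "gend C \<cdot> u"], rule bexI [of _ "scal C (q powi n) (genc C \<cdot> x) + gend C \<cdot> v"])
          (use x uv in \<open>auto simp: simps intro!: deg_part_add deg_part_scal
            deg_part_multI [OF deg_part_gens(3)] deg_part_multI [OF deg_part_gens(4)]\<close>)
    qed
    then show ?case by (simp add: n_def x_def add.commute)
  qed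
  from this [of "letters w"] show ?thesis by simp
qed

lemma dif_deg_part:
  assumes "x \<in> deg_part C n"
  obtains u v where "u \<in> deg_part C (n - 2)" "v \<in> deg_part C (n + 2)"
    "dif C x = form u v (scal C (qint n (q\<^sup>2)) x)"
proof -
  from assms have "\<exists>u\<in>deg_part C (n - 2). \<exists>v\<in>deg_part C (n + 2). dif C x = form u v (scal C (qint n (q\<^sup>2)) x)"
  proof (induction rule: deg_part_induct)
    case zero
    show ?case by (auto simp: form_zero intro!: bexI [of _ 0])
  next
    case (add c w x)
    from add dif_word_val [of w] obtain u v u' v' where
      "u \<in> deg_part C (n - 2)" "v \<in> deg_part C (n + 2)" "u' \<in> deg_part C (n - 2)" "v' \<in> deg_part C (n + 2)"
      "dif C x = form u v (scal C (qint n (q\<^sup>2)) x)"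
      "dif C (word_val C w) = form u' v' (scal C (qint n (q\<^sup>2)) (word_val C w))" by auto
    then show ?case
      by (intro bexI [of _ "scal C c u' + u"] bexI [of _ "scal C c v' + v"])
        (auto simp: dif_add dif_scal vec.scale_right_distrib mult.commute)
  qed
  with that show thesis by blast
qed

text \<open>\<open>(d, - q b)\<close> and \<open>(- q\<^sup>-\<^sup>1 c, a)\<close> are the rows of the inverse of the matrix with columns
  \<open>(a, c)\<close> and \<open>(b, d)\<close>; the coefficients below are the entries of their symmetrised squares, which
  invert the analogous spin one matrix.\<close>

lemma partials_of_forms:
  assumes u: "u \<in> deg_part C (- 2)" and v: "v \<in> deg_part C 2"
  shows "\<exists>F. (\<forall>i. F i \<in> sphere C) \<and>
    form u v 0 = (\<Sum>i\<in>{Minus, Zero, Plus}. F i \<triangleright> dif C (sphere_gen C i))"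
proof -
  define F where "F i = (case i of
      Minus \<Rightarrow> scal C (inverse q ^ 2) (u \<cdot> (genc C \<cdot> genc C)) + v \<cdot> (gend C \<cdot> gend C)
    | Zero \<Rightarrow> - scal C (inverse q) (u \<cdot> (genc C \<cdot> gena C)) - scal C (inverse q ^ 2) (u \<cdot> (gena C \<cdot> genc C))
        - scal C q (v \<cdot> (gend C \<cdot> genb C)) - v \<cdot> (genb C \<cdot> gend C)
    | Plus \<Rightarrow> u \<cdot> (gena C \<cdot> gena C) + scal C (q\<^sup>2) (v \<cdot> (genb C \<cdot> genb C)))" for i
  have "F i \<in> sphere C" for i
    using u v by (cases i) (auto simp: F_def sphere_def simp flip: alg.mult.assoc
        intro!: deg_part_add deg_part_diff deg_part_uminus deg_part_scal)
  moreover have "form u v 0 = (\<Sum>i\<in>{Minus, Zero, Plus}. F i \<triangleright> dif C (sphere_gen C i))"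
    by (simp add: F_def dif_sphere_gen pbw power2_eq_square q_simps del: sphere_gen.simps)
  ultimately show ?thesis by blast
qed

lemma partials_exist:
  assumes "f \<in> sphere C" shows "\<exists>F. partials C f F"
proof -
  from assms obtain u v where "u \<in> deg_part C (- 2)" "v \<in> deg_part C 2" "dif C f = form u v 0"
    unfolding sphere_def by (rule dif_deg_part) auto
  with partials_of_forms [of u v] show ?thesis by (auto simp: partials_def simp del: sum.insert)
qed

section \<open>The one-forms on the sphere\<close>

lemma vector_space_forms: "vector_space (\<lambda>z \<omega>. scal C z (uni C) \<triangleright> \<omega>)"
  by unfold_locales (simp_all add: lact_add_left lact_add_right lact_uni vec.scale_left_distrib mult.commute
      flip: lact_prd)

text \<open>Differentials of degree 0 elements have no \<open>ez\<close> part, which bounds the span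
  from above; conversely \<open>partials_of_forms\<close> writes any such pair of coefficients in
  terms of the differentials of the three generators.\<close>

lemma sphere_forms_eq:
  "sphere_forms C = {form u v 0 |u v. u \<in> deg_part C (- 2) \<and> v \<in> deg_part C 2}" (is "_ = ?F")
proof -
  interpret F: vector_space "\<lambda>z \<omega>. scal C z (uni C) \<triangleright> \<omega>" by (rule vector_space_forms)
  show ?thesis
  proof
    have "F.subspace ?F"
    proof (rule F.subspaceI)
      show "0 \<in> ?F" using form_zero by force
      show "x + y \<in> ?F" if "x \<in> ?F" "y \<in> ?F" for x y
      proof -
        from that obtain u v u' v' where
          "x = form u v 0" "y = form u' v' 0" "u \<in> deg_part C (- 2)" "v \<in> deg_part C 2"
          "u' \<in> deg_part C (- 2)" "v' \<in> deg_part C 2" by auto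
        then show ?thesis
          by (intro CollectI exI [of _ "u + u'"] exI [of _ "v + v'"]) simp
      qed
      show "scal C c (uni C) \<triangleright> x \<in> ?F" if "x \<in> ?F" for c x
      proof -
        from that obtain u v where "x = form u v 0" "u \<in> deg_part C (- 2)" "v \<in> deg_part C 2" by auto
        then show ?thesis
          by (intro CollectI exI [of _ "scal C c u"] exI [of _ "scal C c v"]) simp
      qed
    qed
    moreover have "{m \<triangleright> dif C n |m n. m \<in> sphere C \<and> n \<in> sphere C} \<subseteq> ?F"
    proof clarify
      fix m n assume m: "m \<in> sphere C" and n: "n \<in> sphere C"
      from n obtain u v where "u \<in> deg_part C (- 2)" "v \<in> deg_part C 2" "dif C n = form u v 0"
        unfolding sphere_def by (rule dif_deg_part) auto
      with m show "\<exists>u v. m \<triangleright> dif C n = form u v 0 \<and> u \<in> deg_part C (- 2) \<and> v \<in> deg_part C 2"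
        by (intro exI [of _ "m \<cdot> u"] exI [of _ "m \<cdot> v"]) (auto simp: sphere_def intro: deg_part_multI)
    qed
    ultimately show "sphere_forms C \<subseteq> ?F"
      unfolding sphere_forms_def by (intro F.span_minimal)
    show "?F \<subseteq> sphere_forms C"
    proof clarify
      fix u v assume "u \<in> deg_part C (- 2)" "v \<in> deg_part C 2"
      then obtain F where F: "\<And>i. F i \<in> sphere C"
        and eq: "form u v 0 = (\<Sum>i\<in>{Minus, Zero, Plus}. F i \<triangleright> dif C (sphere_gen C i))"
        using partials_of_forms by blast
      have "F i \<triangleright> dif C (sphere_gen C i) \<in> {m \<triangleright> dif C n |m n. m \<in> sphere C \<and> n \<in> sphere C}" for i
        using F deg_part_sphere_gen [of i] unfolding sphere_def by blast
      then show "form u v 0 \<in> sphere_forms C"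
        unfolding eq sphere_forms_def by (intro F.span_sum F.span_base)
    qed
  qed
qed

section \<open>The balanced tensor product\<close>

lemma sphere_forms_add: "\<omega> \<in> sphere_forms C \<Longrightarrow> \<eta> \<in> sphere_forms C \<Longrightarrow> \<omega> + \<eta> \<in> sphere_forms C"
  unfolding sphere_forms_eq by clarsimp

lemma sphere_forms_zero: "0 \<in> sphere_forms C"
  unfolding sphere_forms_eq using form_zero deg_part_zero by blast

lemma sphere_forms_minus:
  assumes "\<omega> \<in> sphere_forms C" shows "- \<omega> \<in> sphere_forms C"
proof -
  from assms obtain u v where "\<omega> = form u v 0" "u \<in> deg_part C (- 2)" "v \<in> deg_part C 2"
    by (auto simp: sphere_forms_eq)
  then show ?thesis
    unfolding sphere_forms_eq by (intro CollectI exI [of _ "- u"] exI [of _ "- v"]) simp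
qed

lemma sphere_forms_ract:
  assumes "\<omega> \<in> sphere_forms C" "f \<in> sphere C" shows "\<omega> \<triangleleft> f \<in> sphere_forms C"
proof -
  from assms obtain u v where "\<omega> = form u v 0" "u \<in> deg_part C (- 2)" "v \<in> deg_part C 2"
    by (auto simp: sphere_forms_eq)
  with assms(2) show ?thesis
    unfolding sphere_forms_eq
    by (intro CollectI exI [of _ "u \<cdot> f"] exI [of _ "v \<cdot> f"])
      (auto simp: ract_form_deg0 sphere_def intro: deg_part_multI)
qed

lemma spinors_add: "s \<in> spinors C \<Longrightarrow> t \<in> spinors C \<Longrightarrow> s + t \<in> spinors C"
proof (elim spinorsE)
  fix \<sigma> \<tau> \<sigma>' \<tau>'
  assume "s = \<sigma> + \<tau>" "t = \<sigma>' + \<tau>'" "\<sigma> \<in> deg_part C 1" "\<tau> \<in> deg_part C (- 1)"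
    "\<sigma>' \<in> deg_part C 1" "\<tau>' \<in> deg_part C (- 1)"
  then show "s + t \<in> spinors C"
    using spinors_addI [of "\<sigma> + \<sigma>'" "\<tau> + \<tau>'"] by (simp add: algebra_simps)
qed

lemma spinors_lmult:
  assumes "f \<in> sphere C" "s \<in> spinors C" shows "f \<cdot> s \<in> spinors C"
proof -
  from assms(2) obtain \<sigma> \<tau> where "s = \<sigma> + \<tau>" "\<sigma> \<in> deg_part C 1" "\<tau> \<in> deg_part C (- 1)"
    by (rule spinorsE)
  with assms(1) show ?thesis
    by (auto simp: alg.distrib_left sphere_def intro!: spinors_addI intro: deg_part_multI)
qed

section \<open>Formal sums of pairs and their quotient\<close>

abbreviation relations_group :: "('m, 'a) formal_sum set" where
  "relations_group \<equiv> generate (pair_group C) (tensor_relators C)"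

lemma pair_group_carrier:
  "frag_of (\<omega>, s) \<in> carrier (pair_group C) \<longleftrightarrow> \<omega> \<in> sphere_forms C \<and> s \<in> spinors C"
  by (simp add: pair_group_def)

lemma pair_group_diff:
  "u \<in> carrier (pair_group C) \<Longrightarrow> v \<in> carrier (pair_group C) \<Longrightarrow> u - v \<in> carrier (pair_group C)"
  using keys_diff [of u v] by (auto simp: pair_group_def)

lemma pair_group_add:
  "u \<in> carrier (pair_group C) \<Longrightarrow> v \<in> carrier (pair_group C) \<Longrightarrow> u + v \<in> carrier (pair_group C)"
  using keys_add [of u v] by (auto simp: pair_group_def)

text \<open>The closure properties of one-forms and spinors enter here: all pairs in the relators
  must be admissible before the relators can generate a subgroup.\<close>

lemma tensor_relators_carrier: "tensor_relators C \<subseteq> carrier (pair_group C)"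
  unfolding tensor_relators_def
  by (auto intro!: pair_group_diff
      simp: pair_group_carrier sphere_forms_add spinors_add sphere_forms_ract spinors_lmult)

lemma comm_group_pair_group: "comm_group (pair_group C)"
  unfolding pair_group_def by (rule abelian_free_Abelian_group)

lemma relations_group_subgroup: "subgroup relations_group (pair_group C)"
proof -
  interpret G: comm_group "pair_group C" by (rule comm_group_pair_group)
  show ?thesis by (rule G.generate_is_subgroup [OF tensor_relators_carrier])
qed

lemma relations_group_normal: "relations_group \<lhd> pair_group C"
proof -
  interpret G: comm_group "pair_group C" by (rule comm_group_pair_group)
  show ?thesis using relations_group_subgroup by (rule G.subgroup_imp_normal)
qed

lemma comm_group_tensor: "comm_group (tensor C)"
proof -
  interpret G: comm_group "pair_group C" by (rule comm_group_pair_group)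
  show ?thesis unfolding tensor_def using relations_group_subgroup by (rule G.abelian_FactGroup)
qed

lemma tensor_class_add:
  assumes "u \<in> carrier (pair_group C)" "v \<in> carrier (pair_group C)"
  shows "(relations_group #>\<^bsub>pair_group C\<^esub> u) \<otimes>\<^bsub>tensor C\<^esub> (relations_group #>\<^bsub>pair_group C\<^esub> v)
    = relations_group #>\<^bsub>pair_group C\<^esub> (u + v)"
  unfolding tensor_def mult_FactGroup
  using normal.rcos_sum [OF relations_group_normal assms] by (simp add: pair_group_def)

lemma tensor_class_eq:
  assumes "u \<in> carrier (pair_group C)" "v \<in> carrier (pair_group C)" "u - v \<in> tensor_relators C"
  shows "relations_group #>\<^bsub>pair_group C\<^esub> u = relations_group #>\<^bsub>pair_group C\<^esub> v"
proof -
  interpret G: comm_group "pair_group C" by (rule comm_group_pair_group)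
  have "u - v \<in> relations_group" using assms(3) by (rule generate.incl)
  then have "u \<in> relations_group #>\<^bsub>pair_group C\<^esub> v"
    unfolding r_coset_def by (intro UN_I [of "u - v"]) (simp_all add: pair_group_def)
  then show ?thesis
    using G.repr_independence [OF _ assms(2) relations_group_subgroup] by blast
qed

lemma tensor_carrierE:
  assumes "t \<in> carrier (tensor C)"
  obtains u where "u \<in> carrier (pair_group C)" "t = relations_group #>\<^bsub>pair_group C\<^esub> u"
  using assms by (auto simp: tensor_def carrier_FactGroup)

lemma pure_carrier [simp]:
  assumes "\<omega> \<in> sphere_forms C" "s \<in> spinors C" shows "pure C \<omega> s \<in> carrier (tensor C)"
  using assms pair_group_carrier unfolding tensor_def pure_def carrier_FactGroup by blast

lemma pure_add_left:
  assumes "\<omega> \<in> sphere_forms C" "\<eta> \<in> sphere_forms C" "s \<in> spinors C"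
  shows "pure C (\<omega> + \<eta>) s = pure C \<omega> s \<otimes>\<^bsub>tensor C\<^esub> pure C \<eta> s"
proof -
  have "frag_of (\<omega> + \<eta>, s) - (frag_of (\<omega>, s) + frag_of (\<eta>, s)) \<in> tensor_relators C"
    using assms unfolding tensor_relators_def diff_diff_eq [symmetric] by blast
  moreover have "frag_of (\<omega> + \<eta>, s) \<in> carrier (pair_group C)" "frag_of (\<omega>, s) \<in> carrier (pair_group C)"
    "frag_of (\<eta>, s) \<in> carrier (pair_group C)"
    using assms by (simp_all add: pair_group_carrier sphere_forms_add)
  ultimately show ?thesis
    unfolding pure_def by (simp add: tensor_class_add tensor_class_eq pair_group_add)
qed

lemma pure_add_right:
  assumes "\<omega> \<in> sphere_forms C" "s \<in> spinors C" "t \<in> spinors C"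
  shows "pure C \<omega> (s + t) = pure C \<omega> s \<otimes>\<^bsub>tensor C\<^esub> pure C \<omega> t"
proof -
  have "frag_of (\<omega>, s + t) - (frag_of (\<omega>, s) + frag_of (\<omega>, t)) \<in> tensor_relators C"
    using assms unfolding tensor_relators_def diff_diff_eq [symmetric] by blast
  moreover have "frag_of (\<omega>, s + t) \<in> carrier (pair_group C)" "frag_of (\<omega>, s) \<in> carrier (pair_group C)"
    "frag_of (\<omega>, t) \<in> carrier (pair_group C)"
    using assms by (simp_all add: pair_group_carrier spinors_add)
  ultimately show ?thesis
    unfolding pure_def by (simp add: tensor_class_add tensor_class_eq pair_group_add)
qed

lemma pure_balanced:
  assumes "\<omega> \<in> sphere_forms C" "f \<in> sphere C" "s \<in> spinors C"
  shows "pure C (\<omega> \<triangleleft> f) s = pure C \<omega> (f \<cdot> s)"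
proof -
  have "frag_of (\<omega> \<triangleleft> f, s) - frag_of (\<omega>, f \<cdot> s) \<in> tensor_relators C"
    using assms unfolding tensor_relators_def by blast
  then show ?thesis
    unfolding pure_def
    by (intro tensor_class_eq) (simp_all add: assms pair_group_carrier sphere_forms_ract spinors_lmult)
qed

lemma pure_zero [simp]:
  assumes "s \<in> spinors C" shows "pure C 0 s = \<one>\<^bsub>tensor C\<^esub>"
proof -
  interpret T: comm_group "tensor C" by (rule comm_group_tensor)
  \<comment> \<open>An idempotent of a group is the unit.\<close>
  have "pure C 0 s = pure C 0 s \<otimes>\<^bsub>tensor C\<^esub> pure C 0 s"
    using pure_add_left [of 0 0 s] assms by (simp add: sphere_forms_zero)
  then show ?thesis using assms by (simp add: sphere_forms_zero)
qed

lemma inv_pure: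
  assumes "\<omega> \<in> sphere_forms C" "s \<in> spinors C"
  shows "inv\<^bsub>tensor C\<^esub> (pure C \<omega> s) = pure C (- \<omega>) s"
proof -
  interpret T: comm_group "tensor C" by (rule comm_group_tensor)
  have "pure C (- \<omega>) s \<otimes>\<^bsub>tensor C\<^esub> pure C \<omega> s = \<one>\<^bsub>tensor C\<^esub>"
    using assms pure_add_left [of "- \<omega>" \<omega> s] by (simp add: sphere_forms_minus)
  then show ?thesis using assms by (intro T.inv_equality) (simp_all add: sphere_forms_minus)
qed

section \<open>Balanced maps and their lifts to the tensor product\<close>

definition balanced :: "('m \<Rightarrow> 'a \<Rightarrow> 'b::ab_group_add) \<Rightarrow> bool" where
  "balanced \<phi> \<longleftrightarrow>
    (\<forall>\<omega>\<in>sphere_forms C. \<forall>\<eta>\<in>sphere_forms C. \<forall>s\<in>spinors C. \<phi> (\<omega> + \<eta>) s = \<phi> \<omega> s + \<phi> \<eta> s) \<and>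
    (\<forall>\<omega>\<in>sphere_forms C. \<forall>s\<in>spinors C. \<forall>t\<in>spinors C. \<phi> \<omega> (s + t) = \<phi> \<omega> s + \<phi> \<omega> t) \<and>
    (\<forall>\<omega>\<in>sphere_forms C. \<forall>f\<in>sphere C. \<forall>s\<in>spinors C. \<phi> (\<omega> \<triangleleft> f) s = \<phi> \<omega> (f \<cdot> s))"

context
  fixes scale :: "complex \<Rightarrow> 'b \<Rightarrow> 'b::ab_group_add" and \<phi> :: "'m \<Rightarrow> 'a \<Rightarrow> 'b"
  assumes scale: "vector_space scale" and balanced: "balanced \<phi>"
begin

definition lift_sum :: "('m, 'a) formal_sum \<Rightarrow> 'b" where
  "lift_sum u = (\<Sum>(\<omega>, s)\<in>Poly_Mapping.keys u. scale (of_int (Poly_Mapping.lookup u (\<omega>, s))) (\<phi> \<omega> s))"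

lemma lift_sum_add: "lift_sum (u + v) = lift_sum u + lift_sum v"
proof -
  interpret S: vector_space scale by (rule scale)
  have *: "lift_sum w = (\<Sum>k\<in>Poly_Mapping.keys w. scale (of_int (Poly_Mapping.lookup w k)) (\<phi> (fst k) (snd k)))" for w
    by (simp add: lift_sum_def case_prod_unfold)
  show ?thesis
    unfolding *
    by (rule setsum_keys_plus_distrib [where f = "\<lambda>k n. scale (of_int n) (\<phi> (fst k) (snd k))"])
      (simp_all add: S.scale_left_distrib)
qed

lemma lift_sum_frag_of: "lift_sum (frag_of (\<omega>, s)) = \<phi> \<omega> s"
proof -
  interpret S: vector_space scale by (rule scale)
  show ?thesis by (simp add: lift_sum_def)
qed

lemma lift_sum_uminus: "lift_sum (- u) = - lift_sum u"
proof -
  have "lift_sum 0 = 0" by (simp add: lift_sum_def)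
  then show ?thesis using lift_sum_add [of u "- u"] by (simp add: eq_neg_iff_add_eq_0 add.commute)
qed

lemma lift_sum_diff: "lift_sum (u - v) = lift_sum u - lift_sum v"
  using lift_sum_add [of u "- v"] by (simp add: lift_sum_uminus)

lemma lift_sum_relator: "u \<in> tensor_relators C \<Longrightarrow> lift_sum u = 0"
  using balanced by (auto simp: tensor_relators_def balanced_def lift_sum_diff lift_sum_frag_of)

text \<open>The three clauses of \<open>balanced\<close> say that the three families of relators are
  sent to 0; additivity extends this to the subgroup that they generate.\<close>

lemma lift_sum_relations_group:
  assumes "u \<in> relations_group" shows "lift_sum u = 0"
  using assms
proof (induction rule: generate.induct)
  case one
  then show ?case by (simp add: pair_group_def lift_sum_def)
next
  case (incl u)
  then show ?case by (rule lift_sum_relator)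
next
  case (inv u)
  then show ?case
    using tensor_relators_carrier by (auto simp: pair_group_def lift_sum_uminus lift_sum_relator)
next
  case (eng u v)
  then show ?case by (simp add: pair_group_def lift_sum_add)
qed

text \<open>The additive extension is constant on a coset, so its image there is a singleton and
  \<open>the_elem\<close> returns its value at any representative.\<close>

lemma tensor_lift_class:
  assumes "u \<in> carrier (pair_group C)"
  shows "tensor_lift scale \<phi> (relations_group #>\<^bsub>pair_group C\<^esub> u) = lift_sum u"
proof -
  have "lift_sum ` (relations_group #>\<^bsub>pair_group C\<^esub> u) = {lift_sum u}"
  proof -
    have "v \<in> relations_group #>\<^bsub>pair_group C\<^esub> u \<Longrightarrow> lift_sum v = lift_sum u" for v
      unfolding r_coset_def by (auto simp: pair_group_def lift_sum_add lift_sum_relations_group [unfolded pair_group_def])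
    moreover have "u \<in> relations_group #>\<^bsub>pair_group C\<^esub> u"
    proof -
      interpret G: comm_group "pair_group C" by (rule comm_group_pair_group)
      show ?thesis using assms relations_group_subgroup by (rule G.rcos_self)
    qed
    ultimately show ?thesis by blast
  qed
  then show ?thesis
    unfolding tensor_lift_def lift_sum_def [abs_def, symmetric] by simp
qed

lemma tensor_lift_pure:
  assumes "\<omega> \<in> sphere_forms C" "s \<in> spinors C"
  shows "tensor_lift scale \<phi> (pure C \<omega> s) = \<phi> \<omega> s"
  unfolding pure_def using assms by (simp add: tensor_lift_class pair_group_carrier lift_sum_frag_of)

lemma tensor_lift_mult:
  assumes "t \<in> carrier (tensor C)" "t' \<in> carrier (tensor C)"
  shows "tensor_lift scale \<phi> (t \<otimes>\<^bsub>tensor C\<^esub> t') = tensor_lift scale \<phi> t + tensor_lift scale \<phi> t'"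
proof -
  from assms obtain u v where u: "u \<in> carrier (pair_group C)" "t = relations_group #>\<^bsub>pair_group C\<^esub> u"
    and v: "v \<in> carrier (pair_group C)" "t' = relations_group #>\<^bsub>pair_group C\<^esub> v"
    by (elim tensor_carrierE)
  have "u + v \<in> carrier (pair_group C)"
    using u v by (simp add: pair_group_add)
  with u v show ?thesis by (simp add: tensor_class_add tensor_lift_class lift_sum_add)
qed

end

lemma balanced_ract: "balanced (\<lambda>\<omega> s. \<omega> \<triangleleft> s)"
  by (simp add: balanced_def ract_add_left ract_add_right ract_prd)

lemma clifford_pure_add:
  assumes "\<sigma> \<in> deg_part C 1" "\<tau> \<in> deg_part C (- 1)"
  shows "clifford_pure C (form u v w) (\<sigma> + \<tau>) = u \<cdot> \<sigma> + v \<cdot> \<tau>"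
  using assms by (simp add: clifford_pure_def spinor_parts_add)

text \<open>Elements of degree 0 pass \<open>ep\<close> and \<open>em\<close> without a power of
  \<open>q\<close> and preserve the degree of each spinor component, so moving \<open>f\<close>
  across the tensor sign is associativity.\<close>

lemma balanced_clifford_pure: "balanced (clifford_pure C)"
  unfolding balanced_def
proof (intro conjI ballI)
  fix \<omega> \<eta> s t f assume s: "s \<in> spinors C"
  from s obtain \<sigma> \<tau> where *: "s = \<sigma> + \<tau>" "\<sigma> \<in> deg_part C 1" "\<tau> \<in> deg_part C (- 1)"
    by (rule spinorsE)
  obtain u v w where \<omega>: "\<omega> = form u v w" by (rule formE)
  obtain u' v' w' where \<eta>: "\<eta> = form u' v' w'" by (rule formE)
  show "clifford_pure C (\<omega> + \<eta>) s = clifford_pure C \<omega> s + clifford_pure C \<eta> s"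
    using * by (simp add: \<omega> \<eta> clifford_pure_add alg.distrib_right)
  show "clifford_pure C (\<omega> \<triangleleft> f) s = clifford_pure C \<omega> (f \<cdot> s)" if "f \<in> sphere C"
  proof -
    have f: "f \<in> deg_part C 0" using that by (simp add: sphere_def)
    have "f \<cdot> \<sigma> \<in> deg_part C 1" "f \<cdot> \<tau> \<in> deg_part C (- 1)"
      using deg_part_mult [OF f *(2)] deg_part_mult [OF f *(3)] by simp_all
    with * f show ?thesis
      by (simp add: \<omega> ract_form_deg0 clifford_pure_add alg.distrib_left alg.mult.assoc)
  qed
  assume "t \<in> spinors C"
  then obtain \<sigma>' \<tau>' where t: "t = \<sigma>' + \<tau>'" "\<sigma>' \<in> deg_part C 1" "\<tau>' \<in> deg_part C (- 1)"
    by (rule spinorsE)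
  \<comment> \<open>The sum is regrouped by degree first, since \<open>spinor_parts\<close> is known
    only on a sum of a negative and a positive spinor.\<close>
  have "clifford_pure C \<omega> ((\<sigma> + \<sigma>') + (\<tau> + \<tau>')) = u \<cdot> (\<sigma> + \<sigma>') + v \<cdot> (\<tau> + \<tau>')"
    unfolding \<omega> using * t by (intro clifford_pure_add deg_part_add)
  also have "\<dots> = clifford_pure C \<omega> (\<sigma> + \<tau>) + clifford_pure C \<omega> (\<sigma>' + \<tau>')"
    using * t by (simp add: \<omega> clifford_pure_add alg.distrib_left ac_simps)
  finally have "clifford_pure C \<omega> ((\<sigma> + \<sigma>') + (\<tau> + \<tau>'))
    = clifford_pure C \<omega> (\<sigma> + \<tau>) + clifford_pure C \<omega> (\<sigma>' + \<tau>')" .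
  moreover have "s + t = (\<sigma> + \<sigma>') + (\<tau> + \<tau>')" using * t by (simp add: ac_simps)
  ultimately show "clifford_pure C \<omega> (s + t) = clifford_pure C \<omega> s + clifford_pure C \<omega> t"
    using * t by (simp only:)
qed

lemmas tensor_mult_pure = tensor_lift_pure [OF vector_space_forms balanced_ract, folded tensor_mult_def]
  and tensor_mult_mult = tensor_lift_mult [OF vector_space_forms balanced_ract, folded tensor_mult_def]
  and clifford_tensor_pure = tensor_lift_pure [OF vector_space balanced_clifford_pure, folded clifford_def]
  and clifford_tensor_mult = tensor_lift_mult [OF vector_space balanced_clifford_pure, folded clifford_def]

text \<open>From \<open>r x + s y = 1\<close> every \<open>z\<close> of degree \<open>n\<close> is
  \<open>(z r) x + (z s) y\<close>, and the degree 0 factors \<open>z r\<close>, \<open>z s\<close>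
  move into the form. The resulting tensor involves \<omega> and \<open>z\<close> only through their
  product, so multiplication is injective on this summand.\<close>

lemma tensor_part_normal_form:
  assumes xy: "x \<in> deg_part C n" "y \<in> deg_part C n" and rs: "r \<in> deg_part C (- n)" "s \<in> deg_part C (- n)"
    and one: "r \<cdot> x + s \<cdot> y = uni C" and n: "deg_part C n \<subseteq> spinors C"
    and t: "t \<in> tensor_part C n"
  shows "t = pure C (tensor_mult C t \<triangleleft> r) x \<otimes>\<^bsub>tensor C\<^esub> pure C (tensor_mult C t \<triangleleft> s) y"
proof -
  interpret T: comm_group "tensor C" by (rule comm_group_tensor)
  \<comment> \<open>The memberships are carried along because the product of a tensor need not
    itself be a form on the sphere; they are what additivity of \<open>pure\<close> requires when
    two tensors are combined.\<close>
  define Q where "Q t \<longleftrightarrow> t \<in> carrier (tensor C) \<and> tensor_mult C t \<triangleleft> r \<in> sphere_forms C \<and>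
    tensor_mult C t \<triangleleft> s \<in> sphere_forms C \<and>
    t = pure C (tensor_mult C t \<triangleleft> r) x \<otimes>\<^bsub>tensor C\<^esub> pure C (tensor_mult C t \<triangleleft> s) y" for t
  have xy': "x \<in> spinors C" "y \<in> spinors C" using xy n by auto
  have pure: "Q (pure C \<omega> z)" if \<omega>: "\<omega> \<in> sphere_forms C" and z: "z \<in> deg_part C n" for \<omega> z
  proof -
    have zr: "z \<cdot> r \<in> sphere C" "z \<cdot> s \<in> sphere C"
      using deg_part_mult [OF z rs(1)] deg_part_mult [OF z rs(2)] by (simp_all add: sphere_def)
    have z': "z \<in> spinors C" using z n by auto
    have "z = (z \<cdot> r) \<cdot> x + (z \<cdot> s) \<cdot> y"
      using one by (simp add: alg.mult.assoc flip: alg.distrib_left)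
    then have "pure C \<omega> z = pure C \<omega> ((z \<cdot> r) \<cdot> x + (z \<cdot> s) \<cdot> y)" by simp
    also have "\<dots> = pure C (\<omega> \<triangleleft> (z \<cdot> r)) x \<otimes>\<^bsub>tensor C\<^esub> pure C (\<omega> \<triangleleft> (z \<cdot> s)) y"
      using \<omega> zr xy' by (simp add: pure_add_right pure_balanced spinors_lmult)
    finally have split: "pure C \<omega> z = pure C (\<omega> \<triangleleft> (z \<cdot> r)) x \<otimes>\<^bsub>tensor C\<^esub> pure C (\<omega> \<triangleleft> (z \<cdot> s)) y" .
    have "tensor_mult C (pure C \<omega> z) = \<omega> \<triangleleft> z"
      using \<omega> z' by (rule tensor_mult_pure)
    moreover have "pure C \<omega> z \<in> carrier (tensor C)" using \<omega> z' by simp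
    ultimately show ?thesis
      unfolding Q_def using \<omega> zr split by (simp only: sphere_forms_ract simp_thms flip: ract_prd)
  qed
  from t have "Q t"
    unfolding tensor_part_def
  proof (induction rule: generate.induct)
    case one
    have "pure C 0 x = \<one>\<^bsub>tensor C\<^esub>" using xy' by simp
    then show ?case
      using pure [OF sphere_forms_zero xy(1)] by simp
  next
    case (incl t)
    then show ?case using pure by blast
  next
    case (inv t)
    then obtain \<omega> z where "t = pure C \<omega> z" "\<omega> \<in> sphere_forms C" "z \<in> deg_part C n" by blast
    \<comment> \<open>The inverse of a pure tensor is again pure, with the form negated.\<close>
    then show ?case using pure [of "- \<omega>" z] n by (simp add: inv_pure sphere_forms_minus subset_iff)
  next
    case (eng t t')
    let ?p = "\<lambda>t. pure C (tensor_mult C t \<triangleleft> r) x" and ?p' = "\<lambda>t. pure C (tensor_mult C t \<triangleleft> s) y"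
    from eng have mem: "t \<in> carrier (tensor C)" "t' \<in> carrier (tensor C)"
      "tensor_mult C t \<triangleleft> r \<in> sphere_forms C" "tensor_mult C t \<triangleleft> s \<in> sphere_forms C"
      "tensor_mult C t' \<triangleleft> r \<in> sphere_forms C" "tensor_mult C t' \<triangleleft> s \<in> sphere_forms C"
      and t: "t = ?p t \<otimes>\<^bsub>tensor C\<^esub> ?p' t" and t': "t' = ?p t' \<otimes>\<^bsub>tensor C\<^esub> ?p' t'"
      by (simp_all add: Q_def)
    have "t \<otimes>\<^bsub>tensor C\<^esub> t' = (?p t \<otimes>\<^bsub>tensor C\<^esub> ?p' t) \<otimes>\<^bsub>tensor C\<^esub> (?p t' \<otimes>\<^bsub>tensor C\<^esub> ?p' t')"
      using t t' by simp
    also have "\<dots> = (?p t \<otimes>\<^bsub>tensor C\<^esub> ?p t') \<otimes>\<^bsub>tensor C\<^esub> (?p' t \<otimes>\<^bsub>tensor C\<^esub> ?p' t')"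
      using mem xy' by (simp add: T.m_ac)
    also have "\<dots> = pure C (tensor_mult C t \<triangleleft> r + tensor_mult C t' \<triangleleft> r) x \<otimes>\<^bsub>tensor C\<^esub>
        pure C (tensor_mult C t \<triangleleft> s + tensor_mult C t' \<triangleleft> s) y"
      using mem xy' by (simp add: pure_add_left)
    finally have split: "t \<otimes>\<^bsub>tensor C\<^esub> t' =
        pure C (tensor_mult C t \<triangleleft> r + tensor_mult C t' \<triangleleft> r) x \<otimes>\<^bsub>tensor C\<^esub>
        pure C (tensor_mult C t \<triangleleft> s + tensor_mult C t' \<triangleleft> s) y" .
    show ?case
      unfolding Q_def tensor_mult_mult [OF mem(1,2)] ract_add_left
      using mem split by (intro conjI T.m_closed sphere_forms_add)
  qed
  then show ?thesis by (simp add: Q_def)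
qed

text \<open>Uniqueness for the definite description: two tensors with the same product have the same
  normal form, taken with \<open>v\<close>, \<open>x\<close> in degree 1 and with \<open>w\<close>,
  \<open>y\<close> in degree -1. To identify the covariant derivative it thus suffices to compare
  products.\<close>

lemma cov_deriv_hom_eqI:
  assumes n: "n = 1 \<or> n = - 1" and t: "t \<in> tensor_part C n"
    and eq: "tensor_mult C t = dif C \<sigma> - scal C (qint n (q\<^sup>2)) \<sigma> \<triangleright> ez C"
  shows "cov_deriv_hom C q n \<sigma> = t"
  unfolding cov_deriv_hom_def
proof (rule the_equality)
  fix t' assume t': "t' \<in> tensor_part C n \<and> tensor_mult C t' = dif C \<sigma> - scal C (qint n (q\<^sup>2)) \<sigma> \<triangleright> ez C"
  with eq have mult: "tensor_mult C t' = tensor_mult C t" by simp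
  show "t' = t"
    using n
  proof
    assume n: "n = 1"
    have one: "gend C \<cdot> gena C + (- scal C q (genb C)) \<cdot> genc C = uni C"
      using minus_expand [of "uni C"] by simp
    have "u = pure C (tensor_mult C u \<triangleleft> gend C) (gena C) \<otimes>\<^bsub>tensor C\<^esub>
        pure C (tensor_mult C u \<triangleleft> (- scal C q (genb C))) (genc C)" if "u \<in> tensor_part C 1" for u
      by (rule tensor_part_normal_form [OF _ _ _ _ one _ that]) (use deg_part_spinors in auto)
    with t t' n mult show ?thesis by metis
  next
    assume n: "n = - 1"
    have one: "(- scal C (inverse q) (genc C)) \<cdot> genb C + gena C \<cdot> gend C = uni C"
      using plus_expand [of "uni C"] by simp
    have "u = pure C (tensor_mult C u \<triangleleft> (- scal C (inverse q) (genc C))) (genb C) \<otimes>\<^bsub>tensor C\<^esub>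
        pure C (tensor_mult C u \<triangleleft> gena C) (gend C)" if "u \<in> tensor_part C (- 1)" for u
      by (rule tensor_part_normal_form [OF _ _ _ _ one _ that]) (use deg_part_spinors in auto)
    with t t' n mult show ?thesis by metis
  qed
qed (use t eq in simp)

section \<open>The covariant derivative and the Dirac operator\<close>

text \<open>With \<open>v\<close>, \<open>w\<close> the columns \<open>(a, c)\<close>, \<open>(b, d)\<close> and \<open>x\<close>, \<open>y\<close> the rows of the inverse matrix, this is
  \<open>w x ep + q v y em\<close>.\<close>

lemma connection_matrix:
  "mat_mat (ract C) (map_mat (dif C) (proj_e C q)) (proj_e C q)
     - mat_mat (lact C) (proj_e C q) (map_mat (dif C) (proj_e C q)) =
   ((form (genb C \<cdot> gend C) (- (gena C \<cdot> genc C)) 0,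
     form (- scal C q (genb C \<cdot> genb C)) (scal C q (gena C \<cdot> gena C)) 0),
    (form (gend C \<cdot> gend C) (- (genc C \<cdot> genc C)) 0,
     form (- scal C q (gend C \<cdot> genb C)) (scal C q (genc C \<cdot> gena C)) 0))"
proof -
  have neg: "dif C (- x) = - dif C x" for x
    using dif_add [of x "- x"] by (simp add: eq_neg_iff_add_eq_0 add.commute)
  have e: "proj_e C q = ((scal C (- inverse q) (sphere_gen C Zero), scal C q (sphere_gen C Minus)),
      (- sphere_gen C Plus, uni C + scal C q (sphere_gen C Zero)))"
    by (simp add: proj_e_def)
  have de: "map_mat (dif C) (proj_e C q) =
     ((form (- (genb C \<cdot> gend C)) (- (gena C \<cdot> genc C)) 0,
       form (scal C q (genb C \<cdot> genb C)) (scal C q (gena C \<cdot> gena C)) 0),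
      (form (- (gend C \<cdot> gend C)) (- (genc C \<cdot> genc C)) 0,
       form (scal C (q\<^sup>2) (genb C \<cdot> gend C)) (scal C (q\<^sup>2) (gena C \<cdot> genc C)) 0))"
    unfolding e
    by (simp add: map_mat_def map_row_def dif_add dif_scal neg dif_sphere_gen q_cancel power2_eq_square
        del: sphere_gen.simps)
  \<comment> \<open>All entries of \<open>e\<close> have degree 0, so the right action multiplies
    coefficients without powers of \<open>q\<close>.\<close>
  have deg0: "scal C (- inverse q) (sphere_gen C Zero) \<in> deg_part C 0"
    "scal C q (sphere_gen C Minus) \<in> deg_part C 0" "- sphere_gen C Plus \<in> deg_part C 0"
    "uni C + scal C q (sphere_gen C Zero) \<in> deg_part C 0"
    by (simp_all del: sphere_gen.simps)
  show ?thesis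
    unfolding de unfolding e mat_mat_def row_mat_def
    by (simp only: split_conv fst_conv snd_conv ract_form_deg0 [OF deg0(1)] ract_form_deg0 [OF deg0(2)]
        ract_form_deg0 [OF deg0(3)] ract_form_deg0 [OF deg0(4)] lact_form form_add)
      (simp add: pbw q_simps power2_eq_square)
qed

lemma dif_sphereE:
  assumes "f \<in> sphere C"
  obtains u v where "u \<in> deg_part C (- 2)" "v \<in> deg_part C 2" "dif C f = form u v 0"
  using dif_deg_part [of f 0] assms by (auto simp: sphere_def)

lemma connection_row:
  assumes "dif C f = form u v 0" "dif C g = form u' v' 0"
  shows "map_row (dif C) (f, g) + row_mat (lact C) (f, g)
      (mat_mat (ract C) (map_mat (dif C) (proj_e C q)) (proj_e C q)
       - mat_mat (lact C) (proj_e C q) (map_mat (dif C) (proj_e C q))) =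
    (form (u + f \<cdot> (genb C \<cdot> gend C) + g \<cdot> (gend C \<cdot> gend C))
       (v - f \<cdot> (gena C \<cdot> genc C) - g \<cdot> (genc C \<cdot> genc C)) 0,
     form (u' - scal C q (f \<cdot> (genb C \<cdot> genb C)) - scal C q (g \<cdot> (gend C \<cdot> genb C)))
       (v' + scal C q (f \<cdot> (gena C \<cdot> gena C)) + scal C q (g \<cdot> (genc C \<cdot> gena C))) 0)"
  unfolding connection_matrix using assms by (simp add: row_mat_def map_row_def)

lemma tensor_part_pure:
  "\<omega> \<in> sphere_forms C \<Longrightarrow> s \<in> deg_part C n \<Longrightarrow> pure C \<omega> s \<in> tensor_part C n"
  unfolding tensor_part_def by (intro generate.incl) blast

lemma tensor_part_mult:
  "t \<in> tensor_part C n \<Longrightarrow> t' \<in> tensor_part C n \<Longrightarrow> t \<otimes>\<^bsub>tensor C\<^esub> t' \<in> tensor_part C n"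
  unfolding tensor_part_def by (rule generate.eng)

lemma qint_one: "qint 1 t = 1"
  by (simp add: qint_def)

lemma qint_minus_one_q: "qint (- 1) (q\<^sup>2) = - (inverse q ^ 2)"
  using qint_minus_one [of "q\<^sup>2" 0] q_nonzero by (simp add: power_int_minus power_inverse)

text \<open>\<omega> and \<eta> are the entries of the row computed in
  \<open>connection_row\<close>. The degrees 1 and -1 are checked separately by products, and
  additivity of \<open>pure\<close> in the second factor joins the two results.\<close>

lemma cov_deriv_trivialisation:
  assumes "f \<in> sphere C" "g \<in> sphere C"
    and df: "dif C f = form u v 0" "u \<in> deg_part C (- 2)" "v \<in> deg_part C 2"
    and dg: "dif C g = form u' v' 0" "u' \<in> deg_part C (- 2)" "v' \<in> deg_part C 2"
    and \<omega>: "\<omega> = form (u + f \<cdot> (genb C \<cdot> gend C) + g \<cdot> (gend C \<cdot> gend C))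
       (v - f \<cdot> (gena C \<cdot> genc C) - g \<cdot> (genc C \<cdot> genc C)) 0"
    and \<eta>: "\<eta> = form (u' - scal C q (f \<cdot> (genb C \<cdot> genb C)) - scal C q (g \<cdot> (gend C \<cdot> genb C)))
       (v' + scal C q (f \<cdot> (gena C \<cdot> gena C)) + scal C q (g \<cdot> (genc C \<cdot> gena C))) 0"
  shows "\<omega> \<in> sphere_forms C" "\<eta> \<in> sphere_forms C"
    "cov_deriv C q (trivialisation C l (f, g)) =
       pure C \<omega> (gena C + scal C l (genb C)) \<otimes>\<^bsub>tensor C\<^esub> pure C \<eta> (genc C + scal C l (gend C))"
proof -
  interpret T: comm_group "tensor C" by (rule comm_group_tensor)
  have fg: "f \<in> deg_part C 0" "g \<in> deg_part C 0" using assms by (simp_all add: sphere_def)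
  show mem: "\<omega> \<in> sphere_forms C" "\<eta> \<in> sphere_forms C"
    unfolding \<omega> \<eta> sphere_forms_eq using fg df dg by (auto simp flip: alg.mult.assoc)
  have spinors: "gena C \<in> spinors C" "genc C \<in> spinors C"
    "scal C l (genb C) \<in> spinors C" "scal C l (gend C) \<in> spinors C"
    by (simp_all add: deg_part_spinors)
  let ?\<sigma> = "f \<cdot> gena C + g \<cdot> genc C" and ?\<tau> = "scal C l (f \<cdot> genb C + g \<cdot> gend C)"
  let ?t = "pure C \<omega> (gena C) \<otimes>\<^bsub>tensor C\<^esub> pure C \<eta> (genc C)"
    and ?t' = "pure C \<omega> (scal C l (genb C)) \<otimes>\<^bsub>tensor C\<^esub> pure C \<eta> (scal C l (gend C))"
  \<comment> \<open>Complex scalars are central, so \<open>l\<close> can be taken out of the right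
    action and the comparison reduces to the unscaled columns.\<close>
  have scal_ract: "form x y z \<triangleleft> scal C l s = scal C l (uni C) \<triangleright> (form x y z \<triangleleft> s)"
    if "s \<in> deg_part C n" for x y z s n
    using that ract_form [OF that] ract_form [OF deg_part_scal [OF that]] by (simp add: mult.commute)
  have "cov_deriv_hom C q 1 ?\<sigma> = ?t"
  proof (rule cov_deriv_hom_eqI)
    show "?t \<in> tensor_part C 1"
      using mem by (intro tensor_part_mult tensor_part_pure) simp_all
    have "tensor_mult C ?t = \<omega> \<triangleleft> gena C + \<eta> \<triangleleft> genc C"
      using mem spinors by (simp add: tensor_mult_mult tensor_mult_pure)
    also have "\<dots> = dif C ?\<sigma> - scal C (qint 1 (q\<^sup>2)) ?\<sigma> \<triangleright> ez C"
      unfolding \<omega> \<eta>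
      by (simp add: dif_add leibniz df dg dif_gens ract_form_gens ez_form qint_one pbw q_simps power2_eq_square)
    finally show "tensor_mult C ?t = dif C ?\<sigma> - scal C (qint 1 (q\<^sup>2)) ?\<sigma> \<triangleright> ez C" .
  qed simp
  moreover have "cov_deriv_hom C q (- 1) ?\<tau> = ?t'"
  proof (rule cov_deriv_hom_eqI)
    show "?t' \<in> tensor_part C (- 1)"
      using mem by (intro tensor_part_mult tensor_part_pure) simp_all
    have "tensor_mult C ?t' = scal C l (uni C) \<triangleright> (\<omega> \<triangleleft> genb C + \<eta> \<triangleleft> gend C)"
      using mem spinors by (simp add: tensor_mult_mult tensor_mult_pure \<omega> \<eta> scal_ract [of _ "- 1"] lact_add_right
          del: lact_form form_add)
    also have "\<dots> = dif C ?\<tau> - scal C (qint (- 1) (q\<^sup>2)) ?\<tau> \<triangleright> ez C"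
      unfolding \<omega> \<eta> dif_scal qint_minus_one_q
      by (simp add: dif_add leibniz df dg dif_gens ract_form_gens ez_form qint_minus_one_q pbw q_simps
          power2_eq_square)
    finally show "tensor_mult C ?t' = dif C ?\<tau> - scal C (qint (- 1) (q\<^sup>2)) ?\<tau> \<triangleright> ez C" .
  qed simp
  moreover have "spinor_parts C (trivialisation C l (f, g)) = (?\<sigma>, ?\<tau>)"
    unfolding trivialisation_eq using fg by (intro spinor_parts_add) simp_all
  ultimately have "cov_deriv C q (trivialisation C l (f, g)) = ?t \<otimes>\<^bsub>tensor C\<^esub> ?t'"
    by (simp add: cov_deriv_def)
  \<comment> \<open>The same two forms occur in both degrees, so the four pure tensors combine in
    pairs.\<close>
  also have "\<dots> = pure C \<omega> (gena C + scal C l (genb C)) \<otimes>\<^bsub>tensor C\<^esub> pure C \<eta> (genc C + scal C l (gend C))"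
    using mem spinors by (simp add: pure_add_right T.m_ac)
  finally show "cov_deriv C q (trivialisation C l (f, g)) =
       pure C \<omega> (gena C + scal C l (genb C)) \<otimes>\<^bsub>tensor C\<^esub> pure C \<eta> (genc C + scal C l (gend C))" .
qed

text \<open>Only \<open>ep\<close> acts on \<open>v\<close> and only \<open>em\<close> on
  \<open>l w\<close>. The connection \<open>w x ep + q v y em\<close> therefore contributes
  \<open>w x v = w\<close> and \<open>l q v y w = l q v\<close>, which are the terms free of
  derivatives.\<close>

lemma dirac_trivialisation:
  assumes fg: "f \<in> sphere C" "g \<in> sphere C"
    and df: "dif C f = form u v 0" "u \<in> deg_part C (- 2)" "v \<in> deg_part C 2"
    and dg: "dif C g = form u' v' 0" "u' \<in> deg_part C (- 2)" "v' \<in> deg_part C 2"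
  shows "dirac C q (trivialisation C l (f, g)) =
    u \<cdot> gena C + u' \<cdot> genc C + f \<cdot> genb C + g \<cdot> gend C
    + scal C l (v \<cdot> genb C + v' \<cdot> gend C + scal C q (f \<cdot> gena C + g \<cdot> genc C))"
proof -
  interpret T: comm_group "tensor C" by (rule comm_group_tensor)
  note cov = cov_deriv_trivialisation [OF fg df dg refl refl]
  have "gena C + scal C l (genb C) \<in> spinors C" "genc C + scal C l (gend C) \<in> spinors C"
    by (simp_all add: spinors_addI)
  with cov(1,2) show ?thesis
    by (simp only: dirac_def cov(3) clifford_tensor_mult clifford_tensor_pure pure_carrier)
      (simp add: clifford_pure_add pbw q_simps)
qed

lemma partials_form:
  assumes "partials C f F"
  shows "dif C f = form
      (F Minus \<cdot> (genb C \<cdot> genb C) + (scal C q (F Zero \<cdot> (genb C \<cdot> gend C)) + F Plus \<cdot> (gend C \<cdot> gend C)))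
      (F Minus \<cdot> (gena C \<cdot> gena C) + (scal C q (F Zero \<cdot> (gena C \<cdot> genc C)) + F Plus \<cdot> (genc C \<cdot> genc C))) 0"
  using assms by (simp add: partials_def dif_sphere_gen del: sphere_gen.simps)

text \<open>Both sides are expanded into multiples of the coefficients \<open>F\<close>,
  \<open>G\<close> and of \<open>f\<close>, \<open>g\<close>, and compared in normal form. The
  formula needs \<open>l * l = inverse q\<close>, because the Dirac operator exchanges the two
  spinor types while only one of them carries the factor \<open>l\<close>.\<close>

lemma dirac_partials:
  assumes fg: "f \<in> sphere C" "g \<in> sphere C" and F: "partials C f F" and G: "partials C g G"
    and r: "r\<^sup>2 = q" and l: "l = inverse r"
  shows "dirac C q (trivialisation C l (f, g)) =
        trivialisation C l
          (map_row (scal C (l * q)) (f, g)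
           + map_row (scal C (l * inverse q))
               (row_mat (prd C)
                 (map_row (\<lambda>H. \<Sum>i\<in>{Minus, Zero, Plus}. H i \<cdot> sphere_gen C i) (F, G))
                 (mat_one C + map_mat (scal C (q ^ 4 - 1)) (proj_e C q)))
           + map_row (scal C (l * q\<^sup>2))
               (row_mat (prd C)
                 (row_mat (\<lambda>H P. P H) (F, G)
                   ((\<lambda>H. H Zero, \<lambda>H. scal C (inverse q) (H Plus)),
                    (\<lambda>H. - H Minus, \<lambda>H. 0)))
                 (proj_e C q))
           - map_row (scal C l)
               (row_mat (prd C)
                 (row_mat (\<lambda>H P. P H) (F, G)
                   ((\<lambda>H. 0, \<lambda>H. scal C (inverse q) (H Plus)),
                    (\<lambda>H. - H Minus, \<lambda>H. - H Zero)))
                 (mat_one C - proj_e C q)))"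
proof -
  have ll: "l * l = inverse q" using r l by (simp add: power2_eq_square flip: inverse_mult_distrib)
  have ll': "l * (l * z) = inverse q * z" for z using ll by (simp flip: mult.assoc)
  have deg: "F i \<in> deg_part C 0" "G i \<in> deg_part C 0" for i
    using F G by (simp_all add: partials_def sphere_def)
  define M where "M = mat_one C + map_mat (scal C (q ^ 4 - 1)) (proj_e C q)"
  have triv_lin: "trivialisation C l (x + y) = trivialisation C l x + trivialisation C l y"
    "trivialisation C l (x - y) = trivialisation C l x - trivialisation C l y"
    "trivialisation C l (map_row (scal C z) x) = scal C z (trivialisation C l x)" for x y z
    by (cases x; cases y; simp add: trivialisation_def map_row_def alg.distrib_right alg.left_diff_distrib
        vec.scale_right_distrib)+
  \<comment> \<open>Under the trivialisation \<open>e\<close> and \<open>1 - e\<close> become the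
    projections onto positive and negative spinors, by the four relations between \<open>x\<close>,
    \<open>y\<close> and \<open>v\<close>, \<open>w\<close>.\<close>
  have triv_e: "trivialisation C l (row_mat (prd C) (x, y) (proj_e C q)) = scal C l (x \<cdot> genb C + y \<cdot> gend C)"
    for x y
    unfolding row_times_proj trivialisation_eq plus_expand plus_expand_minus by simp
  have triv_one_minus_e:
    "trivialisation C l (row_mat (prd C) (x, y) (mat_one C - proj_e C q)) = x \<cdot> gena C + y \<cdot> genc C" for x y
    unfolding row_times_one_minus_proj trivialisation_eq minus_expand minus_expand_plus by simp
  \<comment> \<open>Hence \<open>1 + (q^4 - 1) e\<close> acts as 1 on negative spinors and as
    \<open>q^4\<close> on positive ones.\<close>
  have triv_M: "trivialisation C l (row_mat (prd C) (x, y) M) =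
       x \<cdot> gena C + y \<cdot> genc C + scal C (q ^ 4) (scal C l (x \<cdot> genb C + y \<cdot> gend C))" for x y
  proof -
    have "row_mat (prd C) (x, y) M = (x, y) + map_row (scal C (q ^ 4 - 1)) (row_mat (prd C) (x, y) (proj_e C q))"
      by (simp add: M_def row_mat_def mat_one_def map_mat_def map_row_def proj_e_def alg.distrib_left
          vec.scale_right_distrib algebra_simps)
    then show ?thesis
      by (simp only: triv_lin triv_e trivialisation_eq vec.scale_left_diff_distrib vec.scale_one) simp
  qed
  have mem: "H Minus \<cdot> (genb C \<cdot> genb C) + (scal C q (H Zero \<cdot> (genb C \<cdot> gend C)) + H Plus \<cdot> (gend C \<cdot> gend C))
      \<in> deg_part C (- 2)"
    "H Minus \<cdot> (gena C \<cdot> gena C) + (scal C q (H Zero \<cdot> (gena C \<cdot> genc C)) + H Plus \<cdot> (genc C \<cdot> genc C))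
      \<in> deg_part C 2"
    if "\<And>i. H i \<in> deg_part C 0" for H :: "sphere_index \<Rightarrow> 'a"
    using that by (simp_all flip: alg.mult.assoc)
  show ?thesis
    unfolding M_def [symmetric] triv_lin
      dirac_trivialisation [OF fg partials_form [OF F] mem [OF deg(1)] partials_form [OF G] mem [OF deg(2)]]
    by (simp only: row_mat_def [of "\<lambda>H P. P H"] map_row_def split_conv map_prod_simp
        triv_e triv_M triv_one_minus_e)
      (simp add: trivialisation_eq pbw q_simps ll ll' power2_eq_square power4_eq_xxxx)
qed

end

text \<open>Since the coefficients are a choice, the operator matrices act on the families
  \<open>F\<close>, \<open>G\<close> and not on \<open>f\<close>, \<open>g\<close>: their entries
  are functions of a family, and application replaces the product. The conjunct on existence of
  \<open>partials\<close> ensures that the Dirac formula covers every \<open>f\<close> and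
  \<open>g\<close>.\<close>

theorem proposition5p6:
  fixes C :: "('a::ab_group_add, 'm::ab_group_add) qsl2_calculus"
    and q r l :: complex and e :: "'a mat2"
  assumes "quantum_SL2_calculus C q"
    and "r\<^sup>2 = q"
    and "l = inverse r"
    and "e = proj_e C q"
  shows
    "sphere_module_iso C (\<lambda>(f, g). f \<cdot>\<^bsub>C\<^esub> gena C + g \<cdot>\<^bsub>C\<^esub> genc C) (rows_times C (mat_one C - e)) (spinors_minus C)
   \<and> sphere_module_iso C (\<lambda>(f, g). f \<cdot>\<^bsub>C\<^esub> genb C + g \<cdot>\<^bsub>C\<^esub> gend C) (rows_times C e) (spinors_plus C)
   \<and> sphere_module_iso C (trivialisation C l) (free_rows C) (spinors C)
   \<and> (\<forall>f\<in>sphere C. \<forall>g\<in>sphere C.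
        cov_deriv C q (trivialisation C l (f, g)) =
          (case map_row (dif C) (f, g)
                + row_mat (lact C) (f, g) (mat_mat (ract C) (map_mat (dif C) e) e - mat_mat (lact C) e (map_mat (dif C) e))
           of (\<omega>, \<eta>) \<Rightarrow>
             pure C \<omega> (gena C + scal C l (genb C)) \<otimes>\<^bsub>tensor C\<^esub> pure C \<eta> (genc C + scal C l (gend C))))
   \<and> (\<forall>f\<in>sphere C. \<exists>F. partials C f F)
   \<and> (\<forall>f\<in>sphere C. \<forall>g\<in>sphere C. \<forall>F G. partials C f F \<longrightarrow> partials C g G \<longrightarrow>
        dirac C q (trivialisation C l (f, g)) =
        trivialisation C l
          (map_row (scal C (l * q)) (f, g)
           + map_row (scal C (l * inverse q))
               (row_mat (prd C)
                 (map_row (\<lambda>H. \<Sum>i\<in>{Minus, Zero, Plus}. H i \<cdot>\<^bsub>C\<^esub> sphere_gen C i) (F, G))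
                 (mat_one C + map_mat (scal C (q ^ 4 - 1)) e))
           + map_row (scal C (l * q\<^sup>2))
               (row_mat (prd C)
                 (row_mat (\<lambda>H P. P H) (F, G)
                   ((\<lambda>H. H Zero, \<lambda>H. scal C (inverse q) (H Plus)),
                    (\<lambda>H. - H Minus, \<lambda>H. 0)))
                 e)
           - map_row (scal C l)
               (row_mat (prd C)
                 (row_mat (\<lambda>H P. P H) (F, G)
                   ((\<lambda>H. 0, \<lambda>H. scal C (inverse q) (H Plus)),
                    (\<lambda>H. - H Minus, \<lambda>H. - H Zero)))
                 (mat_one C - e))))"
proof -
  interpret quantum_SL2_calculus C q by (rule assms(1))
  have "r \<noteq> 0" using assms(2) q_nonzero by auto
  then have l: "l \<noteq> 0" using assms(3) by simp
  show ?thesis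
    unfolding assms(4)
  proof (intro conjI ballI allI impI)
    fix f g assume fg: "f \<in> sphere C" "g \<in> sphere C"
    obtain u v where df: "dif C f = form u v 0" "u \<in> deg_part C (- 2)" "v \<in> deg_part C 2"
      using fg(1) by (rule dif_sphereE)
    obtain u' v' where dg: "dif C g = form u' v' 0" "u' \<in> deg_part C (- 2)" "v' \<in> deg_part C 2"
      using fg(2) by (rule dif_sphereE)
    show "cov_deriv C q (trivialisation C l (f, g)) =
          (case map_row (dif C) (f, g) + row_mat (lact C) (f, g)
              (mat_mat (ract C) (map_mat (dif C) (proj_e C q)) (proj_e C q)
                - mat_mat (lact C) (proj_e C q) (map_mat (dif C) (proj_e C q)))
           of (\<omega>, \<eta>) \<Rightarrow>
             pure C \<omega> (gena C + scal C l (genb C)) \<otimes>\<^bsub>tensor C\<^esub> pure C \<eta> (genc C + scal C l (gend C)))"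
      unfolding connection_row [OF df(1) dg(1)] split_conv
      by (rule cov_deriv_trivialisation(3) [OF fg df dg refl refl])
  qed (fact spinors_minus_iso spinors_plus_iso trivialisation_iso [OF l] partials_exist
      dirac_partials [OF _ _ _ _ assms(2,3)])+
qed

end
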